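(* Let $X,Y$ be simplicial homology $(d-1)$-manifolds. (1) If $d \geq 4$ and $\lceil\frac{d}{2}\rceil \leq k \leq d-2$, then any poset isomorphism $\varphi:\mathscr{F}_{k-1}^{k}(X) \to \mathscr{F}_{k-1}^{k}(Y)$ extends to a poset isomorphism $\mathscr{F}(X) \to \mathscr{F}(Y)$. (2) If $d \geq 3$ is odd, $H_{(d-1)/2}(X,\mathbb{Z}_2)=H_{(d-1)/2}(Y,\mathbb{Z}_2)=0$, and $\frac{d-1}{2} \leq k \leq d-2$, then any poset isomorphism $\varphi:\mathscr{F}_{k-1}^{k}(X) \to \mathscr{F}_{k-1}^{k}(Y)$ extends to a poset isomorphism $\mathscr{F}(X) \to \mathscr{F}(Y)$.
   Context: All simplicial complexes are finite. For a simplicial complex $X$, $\mathscr{F}(X)$ is the poset of all faces of $X$ (including the empty face) ordered by containment, $\mathscr{F}^k(X)$ is the set of $k$-dimensional faces, and for $a \le b$, $\mathscr{F}_a^b(X) := \bigcup_{k=a}^b \mathscr{F}^k(X)$ with the induced partial order. Faces are identified with their vertex sets. For a face $G$ of $X$, the link $\operatorname{Lk}(G,X)$ is the subcomplex with faces $\{A \setminus G : A \in \mathscr{F}(X), G \subseteq A\}$. A simplicial $(d-1)$-pseudomanifold is a $(d-1)$-dimensional simplicial complex that is pure (every face is contained in a $(d-1)$-face) and in which every $(d-2)$-face is contained in exactly two $(d-1)$-faces. A (simplicial) homology $(d-1)$-manifold is a connected simplicial $(d-1)$-pseudomanifold $X$ such that for each $0 \le k \le d-2$ and each $k$-face $G$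 of $X$, the link $\operatorname{Lk}(G,X)$ has the $\mathbb{Z}_2$-homology of a $(d-k-2)$-sphere; that is, when $d-k-2\ge 1$, $H_i(\operatorname{Lk}(G,X),\mathbb{Z}_2)$ is $\mathbb{Z}_2$ for $i=0$ and $i=d-k-2$, and is $0$ for $1 \le i \le d-k-3$. (When $k=d-2$, the link is two points, i.e. a 0-sphere, by the pseudomanifold condition.) *)

theory Defs
  imports Complex_Main "HOL-Library.Z2" "HOL-Algebra.Elementary_Groups"
begin

section \<open>Finite simplicial complexes\<close>

text \<open>A complex is the set of its faces, and a face is its set of vertices. The empty face always
  belongs to the complex; it has dimension \<open>-1\<close>, so dimensions are integers.\<close>

definition simplicial_complex :: "'a set set \<Rightarrow> bool" where
  "simplicial_complex X \<longleftrightarrow>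
     finite X \<and> (\<forall>A\<in>X. finite A) \<and> {} \<in> X \<and> (\<forall>A\<in>X. \<forall>B. B \<subseteq> A \<longrightarrow> B \<in> X)"

definition face_dim :: "'a set \<Rightarrow> int" where
  "face_dim A = int (card A) - 1"

definition faces :: "int \<Rightarrow> 'a set set \<Rightarrow> 'a set set" where
  "faces k X = {A \<in> X. face_dim A = k}"

definition faces_between :: "int \<Rightarrow> int \<Rightarrow> 'a set set \<Rightarrow> 'a set set" where
  "faces_between a b X = (\<Union>k\<in>{a..b}. faces k X)"

definition complex_dim :: "'a set set \<Rightarrow> int" where
  "complex_dim X = Max (face_dim ` X)"

definition link :: "'a set \<Rightarrow> 'a set set \<Rightarrow> 'a set set" where
  "link G X = {A - G |A. A \<in> X \<and> G \<subseteq> A}"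

text \<open>Connectedness of the geometric realization, expressed by edge paths between vertices.\<close>

definition connected_complex :: "'a set set \<Rightarrow> bool" where
  "connected_complex X \<longleftrightarrow> (\<forall>v\<in>\<Union>X. \<forall>w\<in>\<Union>X. (v, w) \<in> {(a, b). {a, b} \<in> X}\<^sup>*)"


section \<open>Simplicial homology with coefficients in the integers modulo 2\<close>

text \<open>A chain is a function to the two-element field \<^typ>\<open>bit\<close>, supported on the faces of dimension
  \<open>i\<close>. The homology is not reduced: the empty face is not a generator, so the chain groups in
  negative degrees are trivial and every \<open>0\<close>-chain is a cycle.\<close>

definition Z2_chain_group :: "int \<Rightarrow> 'a set set \<Rightarrow> ('a set \<Rightarrow> bit) monoid" where
  "Z2_chain_group i X =
     \<lparr>carrier = {c. \<forall>A. c A \<noteq> 0 \<longrightarrow> A \<in> faces i X \<and> A \<noteq> {}},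
      monoid.mult = (\<lambda>c c' A. c A + c' A),
      one = (\<lambda>A. 0)\<rparr>"

definition Z2_boundary :: "int \<Rightarrow> 'a set set \<Rightarrow> ('a set \<Rightarrow> bit) \<Rightarrow> 'a set \<Rightarrow> bit" where
  "Z2_boundary i X c =
     (\<lambda>B. if B \<in> faces (i - 1) X \<and> B \<noteq> {} then \<Sum>A\<in>{A \<in> faces i X. B \<subseteq> A}. c A else 0)"

definition Z2_cycles :: "int \<Rightarrow> 'a set set \<Rightarrow> ('a set \<Rightarrow> bit) set" where
  "Z2_cycles i X = kernel (Z2_chain_group i X) (Z2_chain_group (i - 1) X) (Z2_boundary i X)"

definition Z2_boundaries :: "int \<Rightarrow> 'a set set \<Rightarrow> ('a set \<Rightarrow> bit) set" where
  "Z2_boundaries i X = Z2_boundary (i + 1) X ` carrier (Z2_chain_group (i + 1) X)"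

definition Z2_homology :: "int \<Rightarrow> 'a set set \<Rightarrow> ('a set \<Rightarrow> bit) set monoid" where
  "Z2_homology i X = (Z2_chain_group i X)\<lparr>carrier := Z2_cycles i X\<rparr> Mod Z2_boundaries i X"


section \<open>Homology manifolds\<close>

definition pseudomanifold :: "int \<Rightarrow> 'a set set \<Rightarrow> bool" where
  "pseudomanifold n X \<longleftrightarrow>
     simplicial_complex X \<and> complex_dim X = n \<and>
     (\<forall>A\<in>X. \<exists>B\<in>faces n X. A \<subseteq> B) \<and>
     (\<forall>A\<in>faces (n - 1) X. card {B \<in> faces n X. A \<subseteq> B} = 2)"

text \<open>\<open>L\<close> has the homology of an \<open>m\<close>-sphere. No condition is imposed for \<open>m = 0\<close>: in
  the definition of a homology manifold below, such a link consists of two points because the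
  complex is a pseudomanifold.\<close>

definition has_Z2_homology_of_sphere :: "int \<Rightarrow> 'a set set \<Rightarrow> bool" where
  "has_Z2_homology_of_sphere m L \<longleftrightarrow>
     (m \<ge> 1 \<longrightarrow>
        Z2_homology 0 L \<cong> integer_mod_group 2 \<and>
        Z2_homology m L \<cong> integer_mod_group 2 \<and>
        (\<forall>i\<in>{1..m - 1}. trivial_group (Z2_homology i L)))"

definition homology_manifold :: "int \<Rightarrow> 'a set set \<Rightarrow> bool" where
  "homology_manifold n X \<longleftrightarrow>
     pseudomanifold n X \<and> connected_complex X \<and>
     (\<forall>k\<in>{0..n - 1}. \<forall>G\<in>faces k X. has_Z2_homology_of_sphere (n - k - 1) (link G X))"


section \<open>Isomorphisms of face posets\<close>

definition poset_iso :: "('a set \<Rightarrow> 'b set) \<Rightarrow> 'a set set \<Rightarrow> 'b set set \<Rightarrow> bool" where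
  "poset_iso f P Q \<longleftrightarrow> bij_betw f P Q \<and> (\<forall>A\<in>P. \<forall>B\<in>P. A \<subseteq> B \<longleftrightarrow> f A \<subseteq> f B)"

definition extends_to_iso :: "('a set \<Rightarrow> 'b set) \<Rightarrow> 'a set set \<Rightarrow> 'a set set \<Rightarrow> 'b set set \<Rightarrow> bool" where
  "extends_to_iso f P X Y \<longleftrightarrow> (\<exists>g. poset_iso g X Y \<and> (\<forall>A\<in>P. g A = f A))"

end

theory Submission
  imports Defs
begin

text \<open>Two independent facts carry the theorem: the ranks \<open>k - 1\<close> and \<open>k\<close> of the face poset determine the
  \<open>k\<close>-skeleton up to relabelling of the vertices, and the \<open>k\<close>-skeleton determines the manifold.

  From two ranks to the skeleton (\<open>ranks_iso_skeleton\<close>). A \<open>(k - 2)\<close>-face \<open>G\<close> is the intersection of any two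
  \<open>(k - 1)\<close>-faces through it that lie in a common \<open>k\<close>-face, so its image has to be the intersection of
  their images. This does not depend on the choice: the choices are the edges of the link of \<open>G\<close>, two
  edges of a common triangle give the same intersection, and the edges of the link are connected through
  triangles because the links of \<open>G\<close> and of the \<open>(k - 1)\<close>-faces above \<open>G\<close> are connected; here
  \<open>k \<le> d - 2\<close> enters (\<open>lower_rank_face\<close>). So the isomorphism extends one rank down, and after finitely
  many steps it is induced by a bijection of the vertices.

  From the skeleton to the manifold (\<open>skeleton_determines\<close>). The heart is the case of two manifolds \<open>X\<close>,
  \<open>Y\<close> of even dimension \<open>2 m\<close> with the same \<open>m\<close>-skeleton, where \<open>H\<^sub>m(X) = 0\<close> (\<open>middle_skeleton\<close>).
  Suppose that \<open>V\<close> is an \<open>(m + 1)\<close>-face of \<open>Y\<close> but not of \<open>X\<close>. Then the boundary of \<open>V\<close> is an \<open>m\<close>-sphere in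
  \<open>X\<close>, and for a facet \<open>F\<close> of \<open>V\<close> the link of \<open>F\<close> in \<open>X\<close> is a small \<open>(m - 1)\<close>-sphere around it. By Alexander
  duality this meridian does not bound in the complement of \<open>V\<close> in \<open>X\<close> (\<open>linking_descends\<close>,
  \<open>link_face_not_bounding_sphere\<close>). But it bounds the cone from a vertex of \<open>F\<close>, which lies in the common
  \<open>m\<close>-skeleton; in \<open>Y\<close>, where \<open>V\<close> is an actual face, the cone can be pushed off \<open>V\<close> (\<open>push_off\<close>), and the
  result is again in the common skeleton. This is a contradiction. In general one passes to the links of
  a face \<open>W\<close> of \<open>V\<close> whose size makes the known skeleton of the link exactly the middle one; if \<open>W\<close> is not
  empty, its link is a homology sphere and the vanishing of the middle homology is automatic
  (\<open>next_skeleton\<close>). The empty \<open>W\<close> occurs in the first step of the second claim, and there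
  the vanishing of the middle homology is a hypothesis.

  No duality theorem is invoked: pushing off a face and linking are proved by inductions that pass to
  the link of a vertex, for chains modulo 2 viewed as functions on sets of vertices.\<close>

section \<open>Chains modulo 2\<close>

text \<open>The boundary of reduced homology: the empty face is a generator, so a chain of vertices is a
  cycle only if it has even size. Summing over a fixed ambient vertex set \<open>U\<close> instead of over the faces of a
  complex gives one linear operator for all degrees, which a complex shares with its subcomplexes and
  with its links.\<close>

definition boundary :: "'a set \<Rightarrow> ('a set \<Rightarrow> bit) \<Rightarrow> 'a set \<Rightarrow> bit" where
  "boundary U c B = (\<Sum>v\<in>U - B. c (insert v B))"

text \<open>The degree of a chain counts the vertices of its faces. It is the dimension plus one, so that the
  empty face has degree \<open>0\<close>.\<close>

definition chain :: "'a set set \<Rightarrow> nat \<Rightarrow> ('a set \<Rightarrow> bit) \<Rightarrow> bool" where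
  "chain L j c \<longleftrightarrow> (\<forall>A. c A \<noteq> 0 \<longrightarrow> A \<in> L \<and> card A = j)"

definition bounds_in :: "'a set \<Rightarrow> 'a set set \<Rightarrow> nat \<Rightarrow> ('a set \<Rightarrow> bit) \<Rightarrow> bool" where
  "bounds_in U L j c \<longleftrightarrow> (\<exists>e. chain L (Suc j) e \<and> boundary U e = c)"

definition avoiding :: "'a set \<Rightarrow> 'a set set \<Rightarrow> 'a set set" where
  "avoiding G L = {A \<in> L. A \<inter> G = {}}"

text \<open>For a complex whose facets have \<open>r\<close> vertices, this is its fundamental cycle modulo 2.\<close>

definition facet_chain :: "nat \<Rightarrow> 'a set set \<Rightarrow> 'a set \<Rightarrow> bit" where
  "facet_chain r L A = (if A \<in> L \<and> card A = r then 1 else 0)"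

text \<open>Every chain is the cone from \<open>v\<close> over its \<open>link_part\<close> plus a chain that avoids \<open>v\<close>.\<close>

definition link_part :: "'a \<Rightarrow> ('a set \<Rightarrow> bit) \<Rightarrow> 'a set \<Rightarrow> bit" where
  "link_part v c B = (if v \<in> B then 0 else c (insert v B))"

definition cone :: "'a \<Rightarrow> ('a set \<Rightarrow> bit) \<Rightarrow> 'a set \<Rightarrow> bit" where
  "cone v a A = (if v \<in> A then a (A - {v}) else 0)"

lemma subset_if_image_subset:
  assumes "inj_on f U" "A \<subseteq> U" "B \<subseteq> U" "f ` A \<subseteq> f ` B"
  shows "A \<subseteq> B"
  using assms unfolding inj_on_def by blast

lemma bit_double [simp]: "(x::bit) + x = 0"
  by (cases x) auto

text \<open>These simplification rules rewrite sums of bits into bitwise operations and \<open>x \<noteq> 0\<close> into \<open>x = 1\<close>;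
  the lemmas on sums and supports then no longer match.\<close>

declare bit_not_zero_iff [simp del] bit_not_one_iff [simp del]
  add_bit_eq_xor [simp del] mult_bit_eq_and [simp del]

text \<open>The terms off the diagonal cancel in pairs.\<close>

lemma sum_symmetric_bit:
  fixes f :: "'a \<Rightarrow> 'a \<Rightarrow> bit"
  assumes "finite S" and sym: "\<And>x y. f x y = f y x" and diag: "\<And>x. f x x = 0"
  shows "(\<Sum>x\<in>S. \<Sum>y\<in>S. f x y) = 0"
  using assms(1)
proof induction
  case (insert z S)
  have "(\<Sum>x\<in>insert z S. \<Sum>y\<in>insert z S. f x y) =
    (\<Sum>y\<in>S. f z y) + ((\<Sum>x\<in>S. f x z) + (\<Sum>x\<in>S. \<Sum>y\<in>S. f x y))"
    using insert by (simp add: diag sum.distrib)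
  also have "(\<Sum>x\<in>S. f x z) = (\<Sum>y\<in>S. f z y)" by (intro sum.cong sym) simp
  finally show ?case using insert.IH by (simp add: add.assoc[symmetric])
qed simp

lemma boundary_add: "boundary U (\<lambda>A. c A + e A) = (\<lambda>B. boundary U c B + boundary U e B)"
  by (auto simp: boundary_def sum.distrib fun_eq_iff)

lemma boundary_zero [simp]: "boundary U (\<lambda>_. 0) = (\<lambda>_. 0)"
  by (auto simp: boundary_def fun_eq_iff)

lemma chain_zero [simp]: "chain L j (\<lambda>_. 0)"
  by (simp add: chain_def)

lemma chain_add: "chain L j c \<Longrightarrow> chain L j e \<Longrightarrow> chain L j (\<lambda>A. c A + e A)"
  unfolding chain_def by (metis add_0)

lemma chain_transfer: "chain L j c \<Longrightarrow> (\<And>A. A \<in> L \<Longrightarrow> card A = j \<Longrightarrow> A \<in> M) \<Longrightarrow> chain M j c"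
  by (auto simp: chain_def)

lemma bounds_zero: "bounds_in U L j (\<lambda>_. 0)"
  unfolding bounds_in_def by (metis chain_zero boundary_zero)

text \<open>A set without \<open>g\<close> is reached either by dropping \<open>g\<close> or by dropping another vertex from a set
  that avoids \<open>g\<close>.\<close>

lemma boundary_split:
  assumes "finite U" "g \<in> U" "g \<notin> B"
  shows "boundary U e B = e (insert g B) + boundary U (\<lambda>A. if g \<in> A then 0 else e A) B"
proof -
  have *: "U - B = insert g (U - B - {g})" using assms by auto
  have "boundary U e B = e (insert g B) + (\<Sum>v\<in>U - B - {g}. e (insert v B))"
    unfolding boundary_def by (subst *, subst sum.insert) (use assms in auto)
  also have "(\<Sum>v\<in>U - B - {g}. e (insert v B)) = (\<Sum>v\<in>U - B - {g}. if g \<in> insert v B then 0 else e (insert v B))"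
    by (rule sum.cong) (use assms in auto)
  also have "\<dots> = boundary U (\<lambda>A. if g \<in> A then 0 else e A) B"
    unfolding boundary_def by (subst (2) *, subst sum.insert) (use assms in auto)
  finally show ?thesis .
qed

lemma boundary_link_part:
  assumes "finite U" 
  shows "boundary U (link_part g e) = link_part g (boundary U e)"
proof
  fix B
  show "boundary U (link_part g e) B = link_part g (boundary U e) B"
  proof (cases "g \<in> B")
    case True then show ?thesis by (simp add: boundary_def link_part_def)
  next
    case False
    have "boundary U (link_part g e) B = (\<Sum>v\<in>U - B - {g}. link_part g e (insert v B))"
      unfolding boundary_def using assms by (intro sum.mono_neutral_right) (auto simp: link_part_def)
    also have "\<dots> = (\<Sum>v\<in>U - insert g B. e (insert v (insert g B)))"
      using False by (intro sum.cong) (auto simp: link_part_def insert_commute)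
    finally show ?thesis using False by (simp add: boundary_def link_part_def)
  qed
qed

lemma boundary_vanishes_on_star:
  assumes "\<And>A. g \<in> A \<Longrightarrow> e A = 0" "g \<in> B" shows "boundary U e B = 0"
  using assms by (auto simp: boundary_def)

text \<open>A cone over a cycle fills the cycle: the terms of its boundary that contain the apex form the cone
  over the boundary of the base.\<close>

lemma boundary_cone:
  assumes "finite U" "g \<in> U" "boundary U a = (\<lambda>_. 0)" "\<And>A. g \<in> A \<Longrightarrow> a A = 0"
  shows "boundary U (cone g a) = a"
proof
  fix B
  show "boundary U (cone g a) B = a B"
  proof (cases "g \<in> B")
    case True
    have eq: "U - (B - {g}) = insert g (U - B)" using True assms by auto
    have "boundary U (cone g a) B = (\<Sum>v\<in>U - B. a (insert v (B - {g})))"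
      unfolding boundary_def using True by (intro sum.cong) (auto simp: cone_def insert_Diff_if)
    moreover have "boundary U a (B - {g}) = a B + (\<Sum>v\<in>U - B. a (insert v (B - {g})))"
      unfolding boundary_def eq using True assms by (subst sum.insert) (auto simp: insert_absorb)
    ultimately show ?thesis using assms True by simp
  next
    case False
    have "boundary U (cone g a) B = cone g a (insert g B) + boundary U (\<lambda>A. if g \<in> A then 0 else cone g a A) B"
      by (rule boundary_split) (use assms False in auto)
    also have "(\<lambda>A. if g \<in> A then 0 else cone g a A) = (\<lambda>_. 0)"
      by (auto simp: cone_def)
    finally show ?thesis using False by (simp add: cone_def[of g a "insert g B"])
  qed
qed


section \<open>Links and combinatorial manifolds\<close>

text \<open>What it means for the cycles of a complex with facets of \<open>r\<close> vertices that the complex has the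
  reduced homology of a sphere of dimension \<open>r - 1\<close>.\<close>

definition sphere_like :: "'a set \<Rightarrow> nat \<Rightarrow> 'a set set \<Rightarrow> bool" where
  "sphere_like U r L \<longleftrightarrow> (\<forall>j c. chain L j c \<and> boundary U c = (\<lambda>_. 0) \<longrightarrow>
     (j < r \<longrightarrow> bounds_in U L j c) \<and> (j = r \<longrightarrow> c = (\<lambda>_. 0) \<or> c = facet_chain r L))"

text \<open>Pseudomanifolds, with facets of \<open>r\<close> vertices. The homology of the links is kept apart from
  this condition: links inherit purity and the ridge condition by themselves, and this already provides
  the fundamental cycle of a link, from which its top homology is then computed.\<close>

definition pure_thin :: "'a set \<Rightarrow> nat \<Rightarrow> 'a set set \<Rightarrow> bool" where
  "pure_thin U r L \<longleftrightarrow> simplicial_complex L \<and> finite U \<and> L \<subseteq> Pow U \<and>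
     (\<forall>A\<in>L. \<exists>B\<in>L. A \<subseteq> B \<and> card B = r) \<and>
     (\<forall>A\<in>L. Suc (card A) = r \<longrightarrow> card {B \<in> L. A \<subseteq> B \<and> card B = r} = 2)"

text \<open>A link of a link is a link, so this class is closed under links; the inductions below all run
  through it.\<close>

definition manifold :: "'a set \<Rightarrow> nat \<Rightarrow> 'a set set \<Rightarrow> bool" where
  "manifold U r L \<longleftrightarrow> pure_thin U r L \<and> (\<forall>G\<in>L. G \<noteq> {} \<longrightarrow> sphere_like U (r - card G) (link G L))"

lemma complexD:
  "simplicial_complex L \<Longrightarrow> A \<in> L \<Longrightarrow> B \<subseteq> A \<Longrightarrow> B \<in> L"
  "simplicial_complex L \<Longrightarrow> A \<in> L \<Longrightarrow> finite A"
  "simplicial_complex L \<Longrightarrow> {} \<in> L"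
  "simplicial_complex L \<Longrightarrow> finite L"
  by (auto simp: simplicial_complex_def)

lemma link_iff:
  "simplicial_complex L \<Longrightarrow> A \<in> link G L \<longleftrightarrow> A \<inter> G = {} \<and> A \<union> G \<in> L"
  unfolding link_def
  by (auto intro: exI[of _ "A \<union> G"] simp: Un_absorb2)

lemma link_complex:
  assumes "simplicial_complex L" "G \<in> L"
  shows "simplicial_complex (link G L)"
  unfolding simplicial_complex_def
proof (intro conjI ballI allI impI)
  have "link G L = (\<lambda>A. A - G) ` {A \<in> L. G \<subseteq> A}" by (auto simp: link_def)
  then show "finite (link G L)" using complexD(4)[OF assms(1)] by auto
  show "{} \<in> link G L" using assms by (simp add: link_iff)
  fix A assume A: "A \<in> link G L"
  then show "finite A" using assms complexD(2) by (metis link_iff finite_Un)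
  fix B assume "B \<subseteq> A"
  have AG: "A \<inter> G = {}" "A \<union> G \<in> L" using A assms by (auto simp: link_iff)
  have "B \<union> G \<in> L" by (rule complexD(1)[OF assms(1) AG(2)]) (use \<open>B \<subseteq> A\<close> in auto)
  then show "B \<in> link G L" using AG assms \<open>B \<subseteq> A\<close> by (auto simp: link_iff)
qed

lemma link_link:
  assumes "simplicial_complex L" "H \<in> link G L" "G \<in> L"
  shows "link H (link G L) = link (G \<union> H) L"
  by (rule Set.set_eqI) (use assms link_complex[OF assms(1,3)] in \<open>auto simp: link_iff Un_ac\<close>)

lemma link_empty [simp]: "link {} L = L"
  by (auto simp: link_def)

lemma link_subset: "simplicial_complex L \<Longrightarrow> A \<in> link G L \<Longrightarrow> A \<in> L"
  using complexD(1)[of L "A \<union> G" A] by (auto simp: link_iff)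

lemma pure_thin_finite_face: "pure_thin U r L \<Longrightarrow> A \<in> L \<Longrightarrow> finite A"
  using complexD(2)[of L A] by (simp add: pure_thin_def)

lemma pure_thin_card_le:
  assumes "pure_thin U r L" "A \<in> L" shows "card A \<le> r"
  by (metis assms pure_thin_def card_mono pure_thin_finite_face)

lemma pure_thin_pure: "pure_thin U r L \<Longrightarrow> A \<in> L \<Longrightarrow> \<exists>B\<in>L. A \<subseteq> B \<and> card B = r"
  by (auto simp: pure_thin_def)

text \<open>Adding and removing \<open>G\<close> identifies the faces of the link with the faces above \<open>G\<close>.\<close>

lemma pure_thin_link:
  assumes L: "pure_thin U r L" and G: "G \<in> L"
  shows "pure_thin U (r - card G) (link G L)"
proof -
  have c: "simplicial_complex L" using L by (simp add: pure_thin_def)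
  have finG: "finite G" using c G complexD(2) by blast
  note fin = complexD(2)[OF c]
  have crd: "card (A \<union> G) = card A + card G" if "A \<in> link G L" for A
    using that c finG by (metis link_iff finite_Un fin card_Un_disjoint)
  show ?thesis unfolding pure_thin_def
  proof (intro conjI ballI impI)
    show "simplicial_complex (link G L)" by (rule link_complex[OF c G])
    show "finite U" using L by (simp add: pure_thin_def)
    show "link G L \<subseteq> Pow U" using L c link_subset by (fastforce simp: pure_thin_def)
  next
    fix A assume A: "A \<in> link G L"
    then obtain B where B: "B \<in> L" "A \<union> G \<subseteq> B" "card B = r"
      using pure_thin_pure[OF L] c by (metis link_iff)
    have "B - G \<in> link G L" using B by (auto simp: link_def)
    moreover have "A \<subseteq> B - G" using A c B by (auto simp: link_iff)
    moreover have "card (B - G) = r - card G" using B finG by (simp add: card_Diff_subset)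
    ultimately show "\<exists>B\<in>link G L. A \<subseteq> B \<and> card B = r - card G" by blast
  next
    fix A assume A: "A \<in> link G L" and s: "Suc (card A) = r - card G"
    have s': "Suc (card (A \<union> G)) = r" using crd[OF A] s by simp
    have AG: "A \<union> G \<in> L" using A c by (simp add: link_iff)
    have "bij_betw (\<lambda>B. B - G) {B \<in> L. A \<union> G \<subseteq> B \<and> card B = r} {B \<in> link G L. A \<subseteq> B \<and> card B = r - card G}"
    proof (rule bij_betw_byWitness[where f' = "\<lambda>B. B \<union> G"])
      show "(\<lambda>B. B - G) ` {B \<in> L. A \<union> G \<subseteq> B \<and> card B = r} \<subseteq> {B \<in> link G L. A \<subseteq> B \<and> card B = r - card G}"
        using A c finG by (auto simp: card_Diff_subset link_iff Un_absorb2)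
      show "(\<lambda>B. B \<union> G) ` {B \<in> link G L. A \<subseteq> B \<and> card B = r - card G} \<subseteq> {B \<in> L. A \<union> G \<subseteq> B \<and> card B = r}"
        using c crd pure_thin_card_le[OF L G] by (auto simp: link_iff)
    qed (use c in \<open>auto simp: link_iff\<close>)
    then have "card {B \<in> link G L. A \<subseteq> B \<and> card B = r - card G} = card {B \<in> L. A \<union> G \<subseteq> B \<and> card B = r}"
      by (simp add: bij_betw_same_card)
    then show "card {B \<in> link G L. A \<subseteq> B \<and> card B = r - card G} = 2"
      using L AG s' by (auto simp: pure_thin_def)
  qed
qed

lemma manifold_link:
  assumes L: "manifold U r L" and G: "G \<in> L"
  shows "manifold U (r - card G) (link G L)"
  unfolding manifold_def
proof (intro conjI ballI impI)
  show "pure_thin U (r - card G) (link G L)" using pure_thin_link[of U r L G] L G by (simp add: manifold_def)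
  have c: "simplicial_complex L" using L by (simp add: manifold_def pure_thin_def)
  fix H assume H: "H \<in> link G L" "H \<noteq> {}"
  have GH: "G \<inter> H = {}" "G \<union> H \<in> L" using H(1) c by (auto simp: link_iff Un_commute)
  then have "finite G" "finite H" using complexD(2)[OF c GH(2)] by auto
  then have "card (G \<union> H) = card G + card H" using GH by (simp add: card_Un_disjoint)
  moreover have "sphere_like U (r - card (G \<union> H)) (link (G \<union> H) L)" using L GH H by (auto simp: manifold_def)
  ultimately show "sphere_like U (r - card G - card H) (link H (link G L))"
    using link_link[OF c H(1) G] by simp
qed

lemma manifold_pure_thin: "manifold U r L \<Longrightarrow> pure_thin U r L"
  by (simp add: manifold_def)

lemma manifold_complex: "manifold U r L \<Longrightarrow> simplicial_complex L"
  and manifold_finite: "manifold U r L \<Longrightarrow> finite U"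
  and manifold_vertex: "manifold U r L \<Longrightarrow> {v} \<in> L \<Longrightarrow> v \<in> U"
  by (auto simp: manifold_def pure_thin_def)

lemmas manifold_finite_face = pure_thin_finite_face[OF manifold_pure_thin]
  and manifold_card_le = pure_thin_card_le[OF manifold_pure_thin]
  and manifold_pure = pure_thin_pure[OF manifold_pure_thin]

lemma cofaces_bij:
  assumes c: "simplicial_complex L" and LU: "L \<subseteq> Pow U" and fB: "finite B"
  shows "bij_betw (\<lambda>v. insert v B) {v \<in> U - B. insert v B \<in> L} {A \<in> L. B \<subseteq> A \<and> card A = Suc (card B)}"
proof (rule bij_betw_imageI)
  show "inj_on (\<lambda>v. insert v B) {v \<in> U - B. insert v B \<in> L}"
    by (auto simp: inj_on_def)
  show "(\<lambda>v. insert v B) ` {v \<in> U - B. insert v B \<in> L} = {A \<in> L. B \<subseteq> A \<and> card A = Suc (card B)}"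
  proof (intro equalityI subsetI)
    fix A assume "A \<in> {A \<in> L. B \<subseteq> A \<and> card A = Suc (card B)}"
    then have A: "A \<in> L" "B \<subseteq> A" "card A = Suc (card B)" by auto
    then have "card (A - B) = 1" using fB by (simp add: card_Diff_subset)
    then obtain v where v: "A - B = {v}" by (auto simp: card_1_singleton_iff)
    then have "A = insert v B" "v \<notin> B" using A by auto
    then show "A \<in> (\<lambda>v. insert v B) ` {v \<in> U - B. insert v B \<in> L}" using A LU by auto
  qed (use fB in auto)
qed

lemma manifold_sphere_like: "manifold U r L \<Longrightarrow> G \<in> L \<Longrightarrow> G \<noteq> {} \<Longrightarrow> sphere_like U (r - card G) (link G L)"
  by (auto simp: manifold_def)

lemma sphere_like_cycle_bounds:
  "sphere_like U r L \<Longrightarrow> chain L j c \<Longrightarrow> boundary U c = (\<lambda>_. 0) \<Longrightarrow> j < r \<Longrightarrow> bounds_in U L j c"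
  by (auto simp: sphere_like_def)

lemma sphere_like_top_cycle:
  "sphere_like U r L \<Longrightarrow> chain L r c \<Longrightarrow> boundary U c = (\<lambda>_. 0) \<Longrightarrow> c = (\<lambda>_. 0) \<or> c = facet_chain r L"
  by (auto simp: sphere_like_def)

lemma chain_facet_chain: "chain L r (facet_chain r L)"
  by (auto simp: chain_def facet_chain_def)

lemma chain_too_large:
  assumes "manifold U r L" "chain L j c" "r < j" shows "c = (\<lambda>_. 0)"
  using assms manifold_card_le unfolding chain_def fun_eq_iff by (metis not_less)

text \<open>Each ridge is counted once for each of the two facets that contain it.\<close>

lemma facet_chain_cycle:
  assumes L: "pure_thin U r L"
  shows "boundary U (facet_chain r L) = (\<lambda>_. 0)"
proof
  fix B
  have c: "simplicial_complex L" and U: "finite U" and LU: "L \<subseteq> Pow U" using L by (auto simp: pure_thin_def)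
  show "boundary U (facet_chain r L) B = 0"
  proof (cases "B \<in> L \<and> Suc (card B) = r")
    case True
    have fB: "finite B" using True c complexD(2) by blast
    have "boundary U (facet_chain r L) B = (\<Sum>v\<in>{v \<in> U - B. insert v B \<in> L}. 1)"
      unfolding boundary_def sum.inter_filter[OF finite_Diff[OF U]]
      using True fB by (intro sum.cong) (auto simp: facet_chain_def)
    also have "\<dots> = of_nat (card {v \<in> U - B. insert v B \<in> L})" by simp
    also have "card {v \<in> U - B. insert v B \<in> L} = card {A \<in> L. B \<subseteq> A \<and> card A = r}"
      using bij_betw_same_card[OF cofaces_bij[OF c LU fB]] True by simp
    also have "\<dots> = 2" using L True by (auto simp: pure_thin_def)
    finally show ?thesis by simp
  next
    case False
    then have "facet_chain r L (insert v B) = 0" if "v \<notin> B" for v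
      using that complexD(1)[OF c, of "insert v B" B, OF _ subset_insertI] complexD(2)[OF c, of B]
      by (auto simp: facet_chain_def)
    then show ?thesis by (simp add: boundary_def)
  qed
qed

section \<open>Pushing chains off a face\<close>

lemma avoiding_empty [simp]: "avoiding {} L = L"
  by (simp add: avoiding_def)

lemma manifold_facet_above:
  assumes "manifold U r L" "A \<in> L"
  obtains B where "B \<in> L" "A \<subseteq> B" "card B = r"
  using manifold_pure[OF assms] by blast

text \<open>By purity some facet contains \<open>G\<close>.\<close>

lemma facet_chain_meets:
  assumes "manifold U r L" "G \<in> L" "G \<noteq> {}"
  shows "\<not> chain (avoiding G L) j (facet_chain r L)"
proof
  assume c: "chain (avoiding G L) j (facet_chain r L)"
  obtain B where B: "B \<in> L" "G \<subseteq> B" "card B = r" using manifold_facet_above[OF assms(1,2)] .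
  then have "facet_chain r L B \<noteq> 0" by (simp add: facet_chain_def)
  then have "B \<in> avoiding G L" using c by (auto simp: chain_def)
  then show False using B assms by (auto simp: avoiding_def)
qed

text \<open>If the boundary of \<open>e\<close> misses \<open>g\<close>, then the \<open>link_part\<close> of \<open>e\<close> at \<open>g\<close> is a cycle. A filling of
  this cycle inside the link can replace the part of \<open>e\<close> in the star of \<open>g\<close>.\<close>

lemma bounds_off_vertex:
  assumes U: "finite U" "g \<in> U" and c: "simplicial_complex L" and e: "chain (avoiding H L) (Suc j) e"
    and av: "\<And>B. g \<in> B \<Longrightarrow> boundary U e B = 0"
    and bo: "bounds_in U (avoiding H (link {g} L)) j (link_part g e)"
  shows "bounds_in U (avoiding (insert g H) L) j (boundary U e)"
proof -
  obtain a where a: "chain (avoiding H (link {g} L)) (Suc j) a" "boundary U a = link_part g e"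
    using bo by (auto simp: bounds_in_def)
  have a0: "A \<in> L \<and> A \<inter> insert g H = {} \<and> card A = Suc j" if "a A \<noteq> 0" for A
  proof -
    have "A \<in> link {g} L" "A \<inter> H = {}" "card A = Suc j" using a(1) that by (auto simp: chain_def avoiding_def)
    then show ?thesis using link_subset[OF c, of A "{g}"] by (auto simp: link_iff[OF c])
  qed
  define r where "r = (\<lambda>A. if g \<in> A then 0 else e A)"
  have r0: "A \<in> L \<and> A \<inter> insert g H = {} \<and> card A = Suc j" if "r A \<noteq> 0" for A
    using e that unfolding chain_def avoiding_def r_def by (auto split: if_splits)
  have ch: "chain (avoiding (insert g H) L) (Suc j) (\<lambda>A. r A + a A)"
    by (rule chain_add) (use a0 r0 in \<open>auto simp: chain_def avoiding_def\<close>)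
  have "boundary U (\<lambda>A. r A + a A) B = boundary U e B" for B
  proof (cases "g \<in> B")
    case True
    have "r A + a A = 0" if "g \<in> A" for A using a0[of A] r0[of A] that by (metis Int_iff add_0 insertI1 empty_iff)
    then have "boundary U (\<lambda>A. r A + a A) B = 0" by (rule boundary_vanishes_on_star) (use True in auto)
    then show ?thesis using av True by simp
  next
    case False
    have "boundary U e B = e (insert g B) + boundary U r B"
      unfolding r_def by (rule boundary_split) (use False U in auto)
    then show ?thesis using False by (simp add: boundary_add a(2) link_part_def add.commute)
  qed
  then have "boundary U (\<lambda>A. r A + a A) = boundary U e" by blast
  then show ?thesis using ch by (auto simp: bounds_in_def)
qed

lemma chain_link_part:
  assumes c: "simplicial_complex L" and e: "chain (avoiding H L) (Suc j) e"
  shows "chain (avoiding (H - {g}) (link {g} L)) j (link_part g e)"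
  unfolding chain_def
proof (intro allI impI)
  fix A assume "link_part g e A \<noteq> 0"
  then have g: "g \<notin> A" "e (insert g A) \<noteq> 0" by (auto simp: link_part_def split: if_splits)
  then have *: "insert g A \<in> L" "insert g A \<inter> H = {}" "card (insert g A) = Suc j"
    using e by (auto simp: chain_def avoiding_def)
  then have "finite A" using complexD(2)[OF c] by fastforce
  then show "A \<in> avoiding (H - {g}) (link {g} L) \<and> card A = j"
    using * g by (auto simp: avoiding_def link_iff[OF c])
qed

text \<open>General position, for a chain whose boundary already misses the face. The vertices of
  the face are treated one after the other, and the star of a vertex \<open>g\<close> is replaced as in
  \<open>bounds_off_vertex\<close>. To keep the replacement away from the vertices \<open>G\<close> that were treated before, the induction
  hypothesis is applied inside the link of \<open>g\<close>, which has \<open>G\<close> as a face. In the top degree the link need not fill its cycles;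
  there the cycle is zero or the fundamental cycle of the link. The fundamental cycle is excluded if
  the chain avoids \<open>G\<close>, and for the first vertex it is removed by adding the fundamental cycle of \<open>L\<close>.\<close>

lemma push_off:
  assumes "finite G" "G \<noteq> {}" "manifold U r L" "G \<in> L" "chain L (Suc j) e"
    "\<And>B. B \<inter> G \<noteq> {} \<Longrightarrow> boundary U e B = 0"
  shows "bounds_in U (avoiding G L) j (boundary U e)"
  using assms
proof (induction G arbitrary: r L e rule: finite_ne_induct)
  case (singleton g)
  note c = manifold_complex[OF singleton(1)] and U = manifold_finite[OF singleton(1)] manifold_vertex[OF singleton(1,2)]
  have S: "sphere_like U (r - 1) (link {g} L)" using manifold_sphere_like[OF singleton(1,2)] by simp
  have key: ?case if f: "chain L (Suc j) f" "boundary U f = boundary U e" "bounds_in U (link {g} L) j (link_part g f)" for f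
  proof -
    have "bounds_in U (avoiding (insert g {}) L) j (boundary U f)"
      by (rule bounds_off_vertex) (use U c f singleton in auto)
    then show ?thesis using f by simp
  qed
  have ch: "chain (link {g} L) j (link_part g e)" using chain_link_part[OF c, of "{}" j e g] singleton by simp
  have cy: "boundary U (link_part g e) = (\<lambda>_. 0)"
    using singleton(4) by (auto simp: boundary_link_part U link_part_def fun_eq_iff)
  consider "j < r - 1" | "Suc j = r" | "r < Suc j" by linarith
  then show ?case
  proof cases
    case 1 
    then show ?thesis using key[of e] sphere_like_cycle_bounds[OF S ch cy] singleton by simp
  next
    case 2
    then have "link_part g e = (\<lambda>_. 0) \<or> link_part g e = facet_chain j (link {g} L)"
      using sphere_like_top_cycle[OF S _ cy] ch by auto
    then show ?thesis
    proof
      assume "link_part g e = (\<lambda>_. 0)"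
      then show ?thesis using key[of e] singleton bounds_zero by metis
    next
      assume top: "link_part g e = facet_chain j (link {g} L)"
      \<comment> \<open>The chain contains every facet through \<open>g\<close>. Its complement among the facets has the same
        boundary and contains none of them.\<close>
      define f where "f = (\<lambda>A. e A + facet_chain r L A)"
      have "link_part g f A = 0" for A
      proof (cases "g \<in> A")
        case False
        have "e (insert g A) = facet_chain j (link {g} L) A" using fun_cong[OF top, of A] False by (simp add: link_part_def)
        moreover have "facet_chain r L (insert g A) = facet_chain j (link {g} L) A"
          using False 2 complexD(2)[OF c, of "insert g A"] by (auto simp: facet_chain_def link_iff[OF c])
        ultimately show ?thesis using False by (simp add: link_part_def f_def)
      qed (simp add: link_part_def)
      then have "link_part g f = (\<lambda>_. 0)" by blast
      moreover have "boundary U f = boundary U e"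
        unfolding f_def boundary_add facet_chain_cycle[OF manifold_pure_thin, OF singleton(1)] by simp
      moreover have "chain L (Suc j) f"
        unfolding f_def using singleton 2 chain_facet_chain by (intro chain_add) auto
      ultimately show ?thesis using key[of f] bounds_zero by metis
    qed
  next
    case 3
    then have "e = (\<lambda>_. 0)" using chain_too_large singleton by blast
    then show ?thesis by (simp add: bounds_zero)
  qed
next
  case (insert g G)
  note c = manifold_complex[OF insert.prems(1)] and U = manifold_finite[OF insert.prems(1)]
  have gL: "{g} \<in> L" "G \<in> L" using complexD(1)[OF c insert.prems(2)] by auto
  have gU: "g \<in> U" using manifold_vertex[OF insert.prems(1) gL(1)] .
  have Lk: "manifold U (r - 1) (link {g} L)" using manifold_link[OF insert.prems(1) gL(1)] by simp
  have S: "sphere_like U (r - 1) (link {g} L)" using manifold_sphere_like[OF insert.prems(1) gL(1)] by simp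
  have Glk: "G \<in> link {g} L" using insert by (auto simp: link_iff[OF c])
  have "bounds_in U (avoiding G L) j (boundary U e)" 
    using insert.IH[OF insert.prems(1) gL(2) insert.prems(3)] insert.prems(4) by blast
  then obtain f where f: "chain (avoiding G L) (Suc j) f" "boundary U f = boundary U e"
    by (auto simp: bounds_in_def)
  have ch: "chain (avoiding G (link {g} L)) j (link_part g f)" using chain_link_part[OF c f(1), of g] insert by simp
  have cy: "boundary U (link_part g f) = (\<lambda>_. 0)"
    using insert.prems(4) by (auto simp: boundary_link_part U f link_part_def fun_eq_iff)
  have ch': "chain (link {g} L) j (link_part g f)" using ch by (rule chain_transfer) (auto simp: avoiding_def)
  consider "j < r - 1" | "Suc j = r" | "r < Suc j" by linarith
  then have "bounds_in U (avoiding G (link {g} L)) j (link_part g f)"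
  proof cases
    case 1
    then obtain h where h: "chain (link {g} L) (Suc j) h" "boundary U h = link_part g f"
      using sphere_like_cycle_bounds[OF S ch' cy] by (auto simp: bounds_in_def)
    have "link_part g f B = 0" if "B \<inter> G \<noteq> {}" for B using ch that by (auto simp: chain_def avoiding_def)
    then show ?thesis using insert.IH[OF Lk Glk h(1)] h(2) by metis
  next
    case 2
    then have "link_part g f = (\<lambda>_. 0) \<or> link_part g f = facet_chain (r - 1) (link {g} L)"
      using sphere_like_top_cycle[OF S _ cy] ch' by auto
    then have "link_part g f = (\<lambda>_. 0)" using facet_chain_meets[OF Lk Glk insert.hyps(2)] ch by metis
    then show ?thesis by (simp add: bounds_zero)
  next
    case 3
    have "chain L (Suc j) f" using f(1) by (rule chain_transfer) (auto simp: avoiding_def)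
    then have "f = (\<lambda>_. 0)" using chain_too_large[OF insert.prems(1)] 3 by blast
    then show ?thesis by (simp add: link_part_def[abs_def] bounds_zero)
  qed
  from bounds_off_vertex[OF U gU c f(1) _ this] show ?case
    using insert.prems(4) f(2) by auto
qed

text \<open>In the top degree the fundamental cycle is excluded because it meets \<open>G\<close>. The top
  degree does occur: in the induction for \<open>link_face_not_bounding_sphere\<close>, when \<open>F\<close> is a single vertex.\<close>

lemma sphere_like_cycle_off_face:
  assumes L: "manifold U r L" and S: "sphere_like U r L" and G: "G \<in> L" "G \<noteq> {}"
    and z: "chain (avoiding G L) j z" "boundary U z = (\<lambda>_. 0)"
  shows "bounds_in U L j z"
proof -
  have z': "chain L j z" using z(1) by (rule chain_transfer) (auto simp: avoiding_def)
  consider "j < r" | "j = r" | "r < j" by linarith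
  then show ?thesis
  proof cases
    case 1 then show ?thesis using sphere_like_cycle_bounds[OF S z' z(2)] by simp
  next
    case 2 then have "z = (\<lambda>_. 0)"
      using sphere_like_top_cycle[OF S _ z(2)] z' facet_chain_meets[OF L G] z(1) by metis
    then show ?thesis by (simp add: bounds_zero)
  next
    case 3 then show ?thesis using chain_too_large[OF L z'] by (simp add: bounds_zero)
  qed
qed


section \<open>Linking with the boundary of a missing face\<close>

text \<open>If \<open>l\<close> has a filling \<open>e\<close> off \<open>V\<close>, then the cone from \<open>v\<close> over \<open>l\<close> and \<open>e\<close> together form a cycle that
  avoids the face \<open>V - {v}\<close>. Fill this cycle by \<open>b\<close>, also off \<open>V - {v}\<close>. Near \<open>v\<close> the boundary of \<open>b\<close> is the cone over
  \<open>l\<close>, so the \<open>link_part\<close> of \<open>b\<close> at \<open>v\<close> fills \<open>l\<close> inside the link of \<open>v\<close>.\<close>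

lemma linking_filling_in_vertex_link:
  assumes L: "manifold U r L" and v: "v \<in> V" "{v} \<in> L" and V: "V - {v} \<in> L" "V - {v} \<noteq> {}" "finite V"
    and l: "chain (avoiding V (link {v} L)) j l" "boundary U l = (\<lambda>_. 0)"
    and bnd: "\<And>z. chain (avoiding (V - {v}) L) (Suc j) z \<Longrightarrow> boundary U z = (\<lambda>_. 0) \<Longrightarrow> bounds_in U L (Suc j) z"
    and e: "bounds_in U (avoiding V L) j l"
  shows "bounds_in U (avoiding (V - {v}) (link {v} L)) j l"
proof -
  note c = manifold_complex[OF L] and U = manifold_finite[OF L] manifold_vertex[OF L v(2)]
  obtain e where e: "chain (avoiding V L) (Suc j) e" "boundary U e = l" using e by (auto simp: bounds_in_def)
  have lv: "l A = 0" if "v \<in> A" for A using l(1) v that by (auto simp: chain_def avoiding_def)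
  have lA: "A \<in> link {v} L \<and> A \<inter> V = {} \<and> card A = j" if "l A \<noteq> 0" for A
    using l(1) that by (auto simp: chain_def avoiding_def)
  define z where "z = (\<lambda>A. cone v l A + e A)"
  have "chain (avoiding (V - {v}) L) (Suc j) (cone v l)" unfolding chain_def
  proof (intro allI impI)
    fix A assume "cone v l A \<noteq> 0"
    then have A: "v \<in> A" "l (A - {v}) \<noteq> 0" by (auto simp: cone_def split: if_splits)
    note lA[OF A(2)]
    moreover have "insert v (A - {v}) = A" using A by auto
    ultimately have "A \<in> L" "card (A - {v}) = j" "A \<inter> (V - {v}) = {}" by (auto simp: link_iff[OF c])
    moreover from this have "card A = Suc j"
      using card.remove[OF complexD(2)[OF c] A(1)] by simp
    ultimately show "A \<in> avoiding (V - {v}) L \<and> card A = Suc j" by (simp add: avoiding_def)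
  qed
  moreover have "chain (avoiding (V - {v}) L) (Suc j) e" using e(1) by (rule chain_transfer) (auto simp: avoiding_def)
  ultimately have z: "chain (avoiding (V - {v}) L) (Suc j) z" unfolding z_def by (rule chain_add)
  have bz: "boundary U z = (\<lambda>_. 0)"
  proof -
    have "boundary U (cone v l) = l" by (rule boundary_cone[OF U l(2)]) (use lv in auto)
    then show ?thesis by (simp add: z_def boundary_add e(2))
  qed
  obtain b0 where b0: "chain L (Suc (Suc j)) b0" "boundary U b0 = z"
    using bnd[OF z bz] by (auto simp: bounds_in_def)
  have "bounds_in U (avoiding (V - {v}) L) (Suc j) (boundary U b0)"
    by (rule push_off[OF _ V(2) L V(1) b0(1)]) (use V z in \<open>auto simp: b0(2) chain_def avoiding_def\<close>)
  then obtain b where b: "chain (avoiding (V - {v}) L) (Suc (Suc j)) b" "boundary U b = z"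
    using b0 by (auto simp: bounds_in_def)
  have "chain (avoiding (V - {v}) (link {v} L)) (Suc j) (link_part v b)"
    using chain_link_part[OF c b(1), of v] by simp
  moreover have "boundary U (link_part v b) = l"
  proof
    fix A show "boundary U (link_part v b) A = l A"
    proof (cases "v \<in> A")
      case True then show ?thesis using lv by (simp add: boundary_link_part U link_part_def)
    next
      case False
      have "e (insert v A) = 0" using e(1) v by (auto simp: chain_def avoiding_def)
      then show ?thesis using False by (simp add: boundary_link_part U b(2) link_part_def z_def cone_def)
    qed
  qed
  ultimately show ?thesis by (auto simp: bounds_in_def)
qed

text \<open>A face of the link of \<open>F\<close> that contained \<open>x\<close> would make \<open>V\<close> a face.\<close>

lemma link_of_face_chain:
  assumes L: "manifold U r L" and F: "F \<in> L" and V: "V \<notin> L" "V = insert x F"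
  shows "chain (avoiding V (link F L)) (r - card F) (facet_chain (r - card F) (link F L))"
proof -
  note c = manifold_complex[OF L]
  have "x \<notin> A" if "A \<in> link F L" for A
  proof
    assume "x \<in> A"
    then have "V \<subseteq> A \<union> F" using V by auto
    moreover have "A \<union> F \<in> L" using that link_iff[OF c] by blast
    ultimately show False using complexD(1)[OF c] V by blast
  qed
  then show ?thesis using V by (auto simp: chain_def facet_chain_def avoiding_def link_iff[OF c])
qed

text \<open>The situation of a meridian that bounds off a missing face \<open>insert x F\<close> is inherited by the link of
  a vertex \<open>v\<close> of \<open>F\<close>: there \<open>F - {v}\<close> takes the place of \<open>F\<close>, and the meridian stays the same chain.\<close>

lemma linking_descends:
  fixes L :: "'a set set"
  defines "l \<equiv> \<lambda>r F (L :: 'a set set). facet_chain (r - card F) (link F L)"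
  assumes L: "manifold U r L" and F: "F \<in> L" "v \<in> F" and x: "x \<notin> F" "insert x F \<notin> L"
    and sub: "\<And>A. A \<subset> insert x F \<Longrightarrow> A \<in> L"
    and bnd: "\<And>z. chain (avoiding (insert x F - {v}) L) (Suc (r - card F)) z \<Longrightarrow> boundary U z = (\<lambda>_. 0) \<Longrightarrow>
      bounds_in U L (Suc (r - card F)) z"
    and b: "bounds_in U (avoiding (insert x F) L) (r - card F) (l r F L)"
  defines "K \<equiv> link {v} L" and "F' \<equiv> F - {v}"
  shows "manifold U (r - 1) K" "sphere_like U (r - 1) K" "F' \<in> K" "x \<notin> F'" "insert x F' \<notin> K"
    "A \<subset> insert x F' \<Longrightarrow> A \<in> K"
    "bounds_in U (avoiding (insert x F') K) (r - 1 - card F') (l (r - 1) F' K)"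
proof -
  note c = manifold_complex[OF L]
  have finF: "finite F" using complexD(2)[OF c F(1)] .
  have vL: "{v} \<in> L" using complexD(1)[OF c F(1)] F(2) by auto
  have vx: "insert x F - {v} = insert x F'" "insert v F' = F" "insert v (insert x F') = insert x F"
    using F x by (auto simp: F'_def)
  have VL: "insert x F - {v} \<in> L" by (rule sub) (use F in auto)
  show "manifold U (r - 1) K" "sphere_like U (r - 1) K"
    using manifold_link[OF L vL] manifold_sphere_like[OF L vL] by (auto simp: K_def)
  show FK: "F' \<in> K" 
  proof -
    have "F' \<inter> {v} = {}" "F' \<union> {v} = F" using F(2) by (auto simp: F'_def)
    then show ?thesis unfolding K_def link_iff[OF c] using F(1) by simp
  qed
  show "x \<notin> F'" using x(1) by (simp add: F'_def)
  show "insert x F' \<notin> K" using x(2) vx(3) by (simp add: K_def link_iff[OF c])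
  show "A \<in> K" if "A \<subset> insert x F'"
  proof -
    have v: "v \<notin> A" "v \<notin> insert x F'" using that F(2) x(1) unfolding F'_def by blast+
    then have "insert v A \<noteq> insert v (insert x F')" using that insert_ident[OF v] by blast
    then have "insert v A \<subset> insert x F" using that vx(3) by blast
    note v(1) this
    then show ?thesis using sub by (simp add: link_iff[OF c] K_def)
  qed
  have kk: "link F' K = link F L" 
    using link_link[OF c FK[unfolded K_def] vL] vx(2) by (simp add: K_def)
  have rr: "r - 1 - card F' = r - card F" using card.remove[OF finF F(2)] by (simp add: F'_def)
  have ll: "l (r - 1) F' K = l r F L" by (simp only: l_def kk rr)
  have "chain (avoiding (insert x F) (link F L)) (r - card F) (l r F L)"
    unfolding l_def using link_of_face_chain[OF L F(1) x(2) refl] .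
  then have lk: "chain (avoiding (insert x F) (link {v} L)) (r - card F) (l r F L)"
  proof (rule chain_transfer)
    fix A assume A: "A \<in> avoiding (insert x F) (link F L)"
    then have "insert v A \<in> L" using F
      by (intro complexD(1)[OF c, of "A \<union> F" "insert v A"]) (auto simp: avoiding_def link_iff[OF c])
    then show "A \<in> avoiding (insert x F) (link {v} L)" using A F by (auto simp: avoiding_def link_iff[OF c])
  qed
  have cy: "boundary U (l r F L) = (\<lambda>_. 0)" unfolding l_def using facet_chain_cycle[OF manifold_pure_thin, OF manifold_link[OF L F(1)]] .
  have "bounds_in U (avoiding (insert x F - {v}) (link {v} L)) (r - card F) (l r F L)"
    by (rule linking_filling_in_vertex_link[OF L _ vL VL _ _ lk cy bnd b]) (use F(2) x(1) finF in auto)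
  then show "bounds_in U (avoiding (insert x F') K) (r - 1 - card F') (l (r - 1) F' K)"
    by (simp only: ll rr vx(1) K_def[symmetric])
qed

text \<open>Alexander duality for the boundary of the missing face \<open>insert x F\<close> of a homology sphere: the
  link of \<open>F\<close> winds around it once and cannot bound in the complement. Descending through the links of the
  vertices of \<open>F\<close> ends with the empty face, whose link is the whole sphere; and a fundamental cycle is not
  a boundary because there are no faces of higher dimension.\<close>

lemma link_face_not_bounding_sphere:
  assumes "finite F" "manifold U r L" "sphere_like U r L" "F \<in> L" "x \<notin> F" "insert x F \<notin> L"
    "\<And>A. A \<subset> insert x F \<Longrightarrow> A \<in> L"
  shows "\<not> bounds_in U (avoiding (insert x F) L) (r - card F) (facet_chain (r - card F) (link F L))"
  using assms
proof (induction F arbitrary: r L rule: finite_induct)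
  case empty
  show ?case
  proof
    assume "bounds_in U (avoiding (insert x {}) L) (r - card {}) (facet_chain (r - card {}) (link {} L))"
    then obtain e where e: "chain (avoiding {x} L) (Suc r) e" "boundary U e = facet_chain r L"
      by (auto simp: bounds_in_def)
    have "chain L (Suc r) e" using e(1) by (rule chain_transfer) (auto simp: avoiding_def)
    then have "e = (\<lambda>_. 0)" using chain_too_large empty by blast
    then have "facet_chain r L = (\<lambda>_. 0)" using e by simp
    moreover obtain B where "B \<in> L" "card B = r" using manifold_facet_above[OF empty.prems(1,3)] by blast
    ultimately show False by (metis facet_chain_def zero_neq_one)
  qed
next
  case (insert v F)
  show ?case
  proof
    assume b: "bounds_in U (avoiding (insert x (insert v F)) L) (r - card (insert v F))
      (facet_chain (r - card (insert v F)) (link (insert v F) L))"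
    have VL: "insert x (insert v F) - {v} \<in> L" "insert x (insert v F) - {v} \<noteq> {}"
      using insert.prems(4) by (auto intro!: insert.prems(6))
    have F: "insert v F - {v} = F" using insert.hyps by simp
    note D = linking_descends[OF insert.prems(1,3) insertI1 insert.prems(4-6)
        sphere_like_cycle_off_face[OF insert.prems(1,2) VL] b, unfolded F]
    show False using insert.IH[OF D(1-6)] D(7) by blast
  qed
qed

section \<open>Manifolds with a common skeleton\<close>

text \<open>The link of \<open>F\<close> in \<open>X\<close> would bound off \<open>V\<close> in \<open>X\<close>: its cone from \<open>v\<close> lies in the common skeleton, is
  pushed off the face \<open>V\<close> in \<open>Y\<close>, and stays in the common skeleton.\<close>

lemma middle_skeleton:
  assumes X: "manifold U (2 * m + 1) X" and Y: "manifold U (2 * m + 1) Y" and m: "1 \<le> m"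
    and mid: "\<And>z. chain X (Suc m) z \<Longrightarrow> boundary U z = (\<lambda>_. 0) \<Longrightarrow> bounds_in U X (Suc m) z"
    and skel: "\<And>A. finite A \<Longrightarrow> card A \<le> Suc m \<Longrightarrow> A \<in> X \<longleftrightarrow> A \<in> Y"
    and V: "V \<in> Y" "card V = Suc (Suc m)"
  shows "V \<in> X"
proof (rule ccontr)
  assume VX: "V \<notin> X"
  note cX = manifold_complex[OF X] and cY = manifold_complex[OF Y] and U = manifold_finite[OF X]
  have finV: "finite V" using complexD(2)[OF cY V(1)] .
  have "V \<noteq> {}" using V by auto
  then obtain x where x: "x \<in> V" by blast
  define F where "F = V - {x}"
  have F: "finite F" "card F = Suc m" "x \<notin> F" "insert x F = V" using x V finV by (auto simp: F_def)
  then have "F \<noteq> {}" by auto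
  then obtain v where v: "v \<in> F" by blast
  have sub: "A \<in> X" if "A \<subset> insert x F" for A
  proof -
    have "card A < card V" using that F finV psubset_card_mono by metis
    moreover have "finite A" using that F finV finite_subset by blast
    moreover have "A \<in> Y" using complexD(1)[OF cY V(1)] that F by auto
    ultimately show ?thesis using skel V by auto
  qed
  have FX: "F \<in> X" using sub F(3) by auto
  have vX: "{v} \<in> X" using complexD(1)[OF cX FX] v by auto
  have r: "2 * m + 1 - card F = m" using F by simp
  define l where "l = facet_chain m (link F X)"
  have lch: "chain (avoiding V (link F X)) m l"
    using link_of_face_chain[OF X FX VX F(4)[symmetric]] by (simp only: r l_def)
  have lcy: "boundary U l = (\<lambda>_. 0)"
    using facet_chain_cycle[OF manifold_pure_thin, OF manifold_link[OF X FX]] by (simp only: r l_def)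
  have vU: "v \<in> U" using manifold_vertex[OF X vX] .
  have l0: "l A = 0" if "A \<inter> V \<noteq> {}" for A using lch that by (auto simp: chain_def avoiding_def)
  have lv: "l A = 0" if "v \<in> A" for A using l0 that v F by blast
  have bc: "boundary U (cone v l) = l" by (rule boundary_cone[OF U vU lcy lv])
  have "chain Y (Suc m) (cone v l)"
    unfolding chain_def
  proof (intro allI impI)
    fix A assume "cone v l A \<noteq> 0"
    then have A: "v \<in> A" "l (A - {v}) \<noteq> 0" by (auto simp: cone_def split: if_splits)
    then have *: "A - {v} \<in> link F X" "card (A - {v}) = m" using lch by (auto simp: chain_def avoiding_def)
    have AX: "A \<in> X"
      by (rule complexD(1)[OF cX, of "A - {v} \<union> F"]) (use * v in \<open>auto simp: link_iff[OF cX]\<close>)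
    have "card A = Suc m" using card.remove[OF complexD(2)[OF cX AX] A(1)] * by simp
    then show "A \<in> Y \<and> card A = Suc m" using skel[OF complexD(2)[OF cX AX]] AX by simp
  qed
  then have "bounds_in U (avoiding V Y) m (boundary U (cone v l))"
    using l0 by (intro push_off[OF finV \<open>V \<noteq> {}\<close> Y V(1)]) (auto simp: bc)
  then obtain e where e: "chain (avoiding V Y) (Suc m) e" "boundary U e = l"
    by (auto simp: bounds_in_def bc)
  have "chain (avoiding V X) (Suc m) e"
    using e(1) by (rule chain_transfer) (use skel complexD(2)[OF cY] in \<open>auto simp: avoiding_def\<close>)
  then have b: "bounds_in U (avoiding (insert x F) X) (2 * m + 1 - card F) (facet_chain (2 * m + 1 - card F) (link F X))"
    using e unfolding bounds_in_def l_def r F(4) by blast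
  have bnd: "bounds_in U X (Suc (2 * m + 1 - card F)) z"
    if z: "chain (avoiding (insert x F - {v}) X) (Suc (2 * m + 1 - card F)) z" "boundary U z = (\<lambda>_. 0)" for z
    unfolding r
  proof (rule mid)
    show "chain X (Suc m) z" using z(1) unfolding r by (rule chain_transfer) (auto simp: avoiding_def)
  qed (rule z)
  note D = linking_descends[OF X FX v F(3) VX[folded F(4)] sub bnd b]
  show False
    using link_face_not_bounding_sphere[OF _ D(1-6)] D(7) F(1) by blast
qed

text \<open>Reduction to \<open>middle_skeleton\<close> in the link of a suitable subset \<open>W\<close> of \<open>V\<close>.\<close>

lemma next_skeleton:
  assumes X: "manifold U r X" and Y: "manifold U r Y" and s: "s < r" "r + 1 \<le> 2 * s"
    and mid: "\<And>z. 2 * s = r + 1 \<Longrightarrow> chain X s z \<Longrightarrow> boundary U z = (\<lambda>_. 0) \<Longrightarrow> bounds_in U X s z"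
    and skel: "\<And>A. finite A \<Longrightarrow> card A \<le> s \<Longrightarrow> A \<in> X \<longleftrightarrow> A \<in> Y"
    and V: "V \<in> Y" "card V = Suc s"
  shows "V \<in> X"
proof -
  note cX = manifold_complex[OF X] and cY = manifold_complex[OF Y]
  have finV: "finite V" using complexD(2)[OF cY V(1)] .
  have "2 * s - r - 1 \<le> card V" using V s by simp
  then obtain W where W: "W \<subseteq> V" "card W = 2 * s - r - 1" "finite W"
    using obtain_subset_with_card_n[of "2 * s - r - 1" V] by blast
  \<comment> \<open>Passing to the link lowers \<open>r\<close> and \<open>s\<close> by the size of \<open>W\<close>. For this size the facets of the link have
    \<open>2 * m + 1\<close> vertices, and its faces with up to \<open>m + 1\<close> vertices are known.\<close>
  define m where "m = r - s"
  have m: "1 \<le> m" "r - card W = 2 * m + 1" "card W + Suc m = s" using s W by (auto simp: m_def)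
  have WY: "W \<in> Y" using complexD(1)[OF cY V(1) W(1)] .
  then have WX: "W \<in> X" using skel W s by auto
  have LX: "manifold U (2 * m + 1) (link W X)" and LY: "manifold U (2 * m + 1) (link W Y)"
    using manifold_link[OF X WX] manifold_link[OF Y WY] m by auto
  have "V - W \<in> link W X"
  proof (rule middle_skeleton[OF LX LY m(1)])
    show "bounds_in U (link W X) (Suc m) z" if z: "chain (link W X) (Suc m) z" "boundary U z = (\<lambda>_. 0)" for z
    proof (cases "W = {}")
      case True
      then show ?thesis using mid z m s W by auto
    next
      case False
      then show ?thesis using sphere_like_cycle_bounds[OF manifold_sphere_like[OF X WX] z] m by simp
    qed
    show "A \<in> link W X \<longleftrightarrow> A \<in> link W Y" if "finite A" "card A \<le> Suc m" for A
    proof -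
      have "card (A \<union> W) \<le> s" using card_Un_le[of A W] that m by linarith
      then show ?thesis using skel[of "A \<union> W"] that W by (simp add: link_iff[OF cX] link_iff[OF cY])
    qed
    show "V - W \<in> link W Y" using W V by (auto simp: link_def)
    show "card (V - W) = Suc (Suc m)" using W V m by (simp add: card_Diff_subset)
  qed
  then have "(V - W) \<union> W \<in> X" by (simp add: link_iff[OF cX])
  moreover have "(V - W) \<union> W = V" using W by auto
  ultimately show ?thesis by simp
qed

text \<open>The skeleta agree rank by rank. After the first step \<open>2 * t\<close> exceeds \<open>r + 1\<close>, so the hypothesis on
  cycles is called upon for \<open>t = s\<close> at most.\<close>

lemma skeleton_determines:
  assumes X: "manifold U r X" and Y: "manifold U r Y" and s: "s \<le> r" "r + 1 \<le> 2 * s"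
    and midX: "\<And>z. 2 * s = r + 1 \<Longrightarrow> chain X s z \<Longrightarrow> boundary U z = (\<lambda>_. 0) \<Longrightarrow> bounds_in U X s z"
    and midY: "\<And>z. 2 * s = r + 1 \<Longrightarrow> chain Y s z \<Longrightarrow> boundary U z = (\<lambda>_. 0) \<Longrightarrow> bounds_in U Y s z"
    and skel: "\<And>A. finite A \<Longrightarrow> card A \<le> s \<Longrightarrow> A \<in> X \<longleftrightarrow> A \<in> Y"
  shows "X = Y"
proof -
  have agree: "\<forall>A. finite A \<longrightarrow> card A \<le> t \<longrightarrow> (A \<in> X \<longleftrightarrow> A \<in> Y)" if "s \<le> t" "t \<le> r" for t
    using that
  proof (induction t rule: dec_induct)
    case base then show ?case using skel by blast
  next
    case (step t)
    have IH: "A \<in> X \<longleftrightarrow> A \<in> Y" "A \<in> Y \<longleftrightarrow> A \<in> X" if "finite A" "card A \<le> t" for A 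
      using step that by auto
    have t: "t < r" "r + 1 \<le> 2 * t" using step s by auto
    have eq: "t = s" if "2 * t = r + 1" using that step s by auto
    have XY: "A \<in> X \<longleftrightarrow> A \<in> Y" if A: "card A = Suc t" for A
    proof
      assume "A \<in> Y"
      then show "A \<in> X" using next_skeleton[OF X Y t _ IH(1)] midX eq A by blast
    next
      assume "A \<in> X"
      then show "A \<in> Y" using next_skeleton[OF Y X t _ IH(2)] midY eq A by blast
    qed
    show ?case using IH XY by (metis le_SucE)
  qed
  show ?thesis
    using agree[OF s(1) order_refl] manifold_card_le[OF X] manifold_card_le[OF Y]
      manifold_finite_face[OF X] manifold_finite_face[OF Y] by blast
qed

section \<open>Relabelling the vertices\<close>

text \<open>The map \<open>f\<close> will be injective only on \<open>U\<close>. Sets that leave \<open>U\<close> may share their image with subsets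
  of \<open>U\<close> and are therefore given the value \<open>0\<close>.\<close>

definition pullback :: "('a \<Rightarrow> 'b) \<Rightarrow> 'a set \<Rightarrow> ('b set \<Rightarrow> bit) \<Rightarrow> 'a set \<Rightarrow> bit" where
  "pullback f U c A = (if A \<subseteq> U then c (f ` A) else 0)"

lemma boundary_pullback:
  assumes inj: "inj_on f U"
  shows "boundary U (pullback f U c) = pullback f U (boundary (f ` U) c)"
proof
  fix B
  show "boundary U (pullback f U c) B = pullback f U (boundary (f ` U) c) B"
  proof (cases "B \<subseteq> U")
    case True
    have "f ` U - f ` B = f ` (U - B)" using inj_on_image_set_diff[OF inj, of U B] True by auto
    moreover have "inj_on f (U - B)" using inj inj_on_subset by blast
    ultimately have "boundary (f ` U) c (f ` B) = (\<Sum>v\<in>U - B. c (insert (f v) (f ` B)))"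
      by (simp add: boundary_def sum.reindex)
    also have "\<dots> = boundary U (pullback f U c) B"
      unfolding boundary_def using True by (intro sum.cong) (auto simp: pullback_def)
    finally show ?thesis using True by (simp add: pullback_def)
  qed (auto simp: pullback_def boundary_def)
qed

lemma pullback_zero [simp]: "pullback f U (\<lambda>_. 0) = (\<lambda>_. 0)"
  by (auto simp: pullback_def)

lemma pullback_inverse:
  assumes inj: "inj_on f U" and c: "\<And>A. c A \<noteq> 0 \<Longrightarrow> A \<subseteq> f ` U"
  shows "pullback (inv_into U f) (f ` U) (pullback f U c) = c"
proof
  fix A
  show "pullback (inv_into U f) (f ` U) (pullback f U c) A = c A"
  proof (cases "A \<subseteq> f ` U")
    case True
    then have "inv_into U f ` A \<subseteq> U" "f ` inv_into U f ` A = A"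
      by (auto simp: inv_into_into subset_iff image_iff f_inv_into_f)
    then show ?thesis using True by (simp add: pullback_def)
  qed (use c in \<open>auto simp: pullback_def\<close>)
qed

lemma chain_pullback:
  assumes inj: "inj_on f U" and L: "L \<subseteq> Pow U" and c: "chain ((`) f ` L) j c"
  shows "chain L j (pullback f U c)"
  unfolding chain_def
proof (intro allI impI)
  fix A assume "pullback f U c A \<noteq> 0"
  then have A: "A \<subseteq> U" "f ` A \<in> (`) f ` L" "card (f ` A) = j"
    using c by (auto simp: pullback_def chain_def split: if_splits)
  then obtain B where "B \<in> L" "f ` A = f ` B" by auto
  then have "A \<in> L" using inj_on_image_eq_iff[OF inj, of A B] A L by auto
  moreover have "card A = j" using card_image[OF inj_on_subset[OF inj A(1)]] A by simp
  ultimately show "A \<in> L \<and> card A = j" by simp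
qed

lemma inv_image_complex:
  assumes inj: "inj_on f U" and L: "L \<subseteq> Pow U"
  shows "(`) (inv_into U f) ` (`) f ` L = L"
proof -
  have "inv_into U f ` f ` A = A" if "A \<in> L" for A
    using inv_into_image_cancel[OF inj, of A] L that by auto
  then show ?thesis by (force simp: image_iff)
qed

text \<open>Pull the cycle back, fill it, and pull the filling back along the inverse relabelling.\<close>

lemma cycles_bound_image:
  assumes inj: "inj_on f U" and L: "L \<subseteq> Pow U"
    and bnd: "\<And>c. chain L j c \<Longrightarrow> boundary U c = (\<lambda>_. 0) \<Longrightarrow> bounds_in U L j c"
    and c: "chain ((`) f ` L) j c" "boundary (f ` U) c = (\<lambda>_. 0)"
  shows "bounds_in (f ` U) ((`) f ` L) j c"
proof -
  let ?g = "inv_into U f" and ?W = "f ` U"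
  have injg: "inj_on ?g ?W" by (rule inj_on_inv_into) simp
  have gW: "?g ` ?W = U" using inv_into_image_cancel[OF inj, of U] by simp
  have gL: "(`) ?g ` ((`) f ` L) = L" by (rule inv_image_complex[OF inj L])
  have LW: "(`) f ` L \<subseteq> Pow ?W" using L by auto
  have "boundary U (pullback f U c) = (\<lambda>_. 0)" by (simp add: boundary_pullback[OF inj] c)
  then obtain e where e: "chain L (Suc j) e" "boundary U e = pullback f U c"
    using bnd[OF chain_pullback[OF inj L c(1)]] by (auto simp: bounds_in_def)
  have "chain ((`) f ` L) (Suc j) (pullback ?g ?W e)"
    by (rule chain_pullback[OF injg LW]) (simp add: gL e)
  moreover have "boundary ?W (pullback ?g ?W e) = c"
  proof -
    have "boundary ?W (pullback ?g ?W e) = pullback ?g ?W (pullback f U c)"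
      by (simp add: boundary_pullback[OF injg] gW e)
    also have "\<dots> = c" by (rule pullback_inverse[OF inj]) (use c(1) LW in \<open>unfold chain_def, blast\<close>)
    finally show ?thesis .
  qed
  ultimately show ?thesis by (auto simp: bounds_in_def)
qed

lemma sphere_like_image:
  assumes inj: "inj_on f U" and L: "L \<subseteq> Pow U" and S: "sphere_like U r L"
  shows "sphere_like (f ` U) r ((`) f ` L)"
  unfolding sphere_like_def
proof (intro allI impI, elim conjE, intro conjI impI)
  fix j c assume c: "chain ((`) f ` L) j c" "boundary (f ` U) c = (\<lambda>_. 0)"
  show "bounds_in (f ` U) ((`) f ` L) j c" if "j < r"
    using cycles_bound_image[OF inj L sphere_like_cycle_bounds[OF S] c] that by blast
  assume j: "j = r"
  have c0: "A \<subseteq> f ` U" if "c A \<noteq> 0" for A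
  proof -
    have "A \<in> (`) f ` L" using c(1) that unfolding chain_def by blast
    then show ?thesis using L by auto
  qed
  have pp: "pullback (inv_into U f) (f ` U) (pullback f U c) = c"
    by (rule pullback_inverse[OF inj]) (rule c0)
  have "boundary U (pullback f U c) = (\<lambda>_. 0)" by (simp add: boundary_pullback[OF inj] c)
  then consider "pullback f U c = (\<lambda>_. 0)" | "pullback f U c = facet_chain r L"
    using sphere_like_top_cycle[OF S] chain_pullback[OF inj L c(1)] j by blast
  then show "c = (\<lambda>_. 0) \<or> c = facet_chain r ((`) f ` L)"
  proof cases
    case 1
    then show ?thesis using pp by simp
  next
    case 2
    have "pullback f U (facet_chain r ((`) f ` L)) = facet_chain r L"
    proof
      fix A
      show "pullback f U (facet_chain r ((`) f ` L)) A = facet_chain r L A"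
      proof (cases "A \<subseteq> U")
        case True
        have "f ` A \<in> (`) f ` L \<longleftrightarrow> A \<in> L"
        proof
          assume "f ` A \<in> (`) f ` L"
          then obtain B where "B \<in> L" "f ` A = f ` B" by auto
          then show "A \<in> L" using inj_on_image_eq_iff[OF inj, of A B] True L by auto
        qed simp
        then show ?thesis using True card_image[OF inj_on_subset[OF inj True]]
          by (simp add: pullback_def facet_chain_def)
      qed (use L in \<open>auto simp: pullback_def facet_chain_def\<close>)
    qed
    then have "c = pullback (inv_into U f) (f ` U) (pullback f U (facet_chain r ((`) f ` L)))"
      using pp 2 by simp
    also have "\<dots> = facet_chain r ((`) f ` L)"
      by (rule pullback_inverse[OF inj]) (use L in \<open>auto simp: facet_chain_def split: if_splits\<close>)
    finally show ?thesis by simp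
  qed
qed

lemma link_image:
  assumes inj: "inj_on f U" and L: "L \<subseteq> Pow U" and G: "G \<in> L"
  shows "link (f ` G) ((`) f ` L) = (`) f ` link G L"
proof (rule Set.set_eqI)
  fix B
  have sub: "f ` G \<subseteq> f ` A \<longleftrightarrow> G \<subseteq> A" and dif: "f ` A - f ` G = f ` (A - G)" if "A \<in> L" for A
    
  proof -
    have GA: "G \<subseteq> U" "A \<subseteq> U" using L G that by auto
    show "f ` G \<subseteq> f ` A \<longleftrightarrow> G \<subseteq> A" using subset_if_image_subset[OF inj GA] by auto
    show "f ` A - f ` G = f ` (A - G)" using inj_on_image_set_diff[OF inj, of A G] GA by auto
  qed
  have "B \<in> link (f ` G) ((`) f ` L) \<longleftrightarrow> (\<exists>A\<in>L. B = f ` A - f ` G \<and> f ` G \<subseteq> f ` A)"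
    by (auto simp: link_def)
  also have "\<dots> \<longleftrightarrow> (\<exists>A\<in>L. B = f ` (A - G) \<and> G \<subseteq> A)" using sub dif by auto
  also have "\<dots> \<longleftrightarrow> B \<in> (`) f ` link G L" by (auto simp: link_def)
  finally show "B \<in> link (f ` G) ((`) f ` L) \<longleftrightarrow> B \<in> (`) f ` link G L" .
qed

lemma complex_image:
  assumes "simplicial_complex L"
  shows "simplicial_complex ((`) f ` L)"
  unfolding simplicial_complex_def
proof (intro conjI ballI allI impI)
  fix B C assume "B \<in> (`) f ` L" "C \<subseteq> B"
  then obtain A where "A \<in> L" "C \<subseteq> f ` A" by auto
  then obtain A' where "A' \<subseteq> A" "C = f ` A'" by (auto simp: subset_image_iff)
  then show "C \<in> (`) f ` L" using complexD(1)[OF assms \<open>A \<in> L\<close>] by auto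
qed (use complexD(2-4)[OF assms] in auto)

lemma manifold_image:
  assumes inj: "inj_on f U" and L: "manifold U r L"
  shows "manifold (f ` U) r ((`) f ` L)"
proof -
  have LU: "L \<subseteq> Pow U" using L by (auto simp: manifold_def pure_thin_def)
  have crd: "card (f ` A) = card A" if "A \<in> L" for A
    using card_image inj_on_subset[OF inj] LU that by blast
  have sub: "f ` A \<subseteq> f ` B \<longleftrightarrow> A \<subseteq> B" if "A \<in> L" "B \<in> L" for A B
    using subset_if_image_subset[OF inj, of A B] LU that by auto
  show ?thesis unfolding manifold_def pure_thin_def
  proof (intro conjI ballI impI)
    show "simplicial_complex ((`) f ` L)" by (rule complex_image[OF manifold_complex[OF L]])
    show "finite (f ` U)" using manifold_finite[OF L] by simp
    show "(`) f ` L \<subseteq> Pow (f ` U)" using LU by auto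
  next
    fix A' assume "A' \<in> (`) f ` L"
    then obtain A where A: "A \<in> L" "A' = f ` A" by auto
    obtain B where "B \<in> L" "A \<subseteq> B" "card B = r" using manifold_pure[OF L A(1)] by blast
    then show "\<exists>B\<in>(`) f ` L. A' \<subseteq> B \<and> card B = r" using A crd by (auto intro!: bexI[of _ "f ` B"])
  next
    fix A' assume "A' \<in> (`) f ` L" "Suc (card A') = r"
    then obtain A where A: "A \<in> L" "A' = f ` A" "Suc (card A) = r" using crd by auto
    have eq: "{B \<in> (`) f ` L. A' \<subseteq> B \<and> card B = r} = (`) f ` {B \<in> L. A \<subseteq> B \<and> card B = r}"
      using A sub crd by auto
    have "inj_on ((`) f) {B \<in> L. A \<subseteq> B \<and> card B = r}"
      by (rule inj_on_subset[OF inj_on_image_Pow[OF inj]]) (use LU in auto)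
    then have "card {B \<in> (`) f ` L. A' \<subseteq> B \<and> card B = r} = card {B \<in> L. A \<subseteq> B \<and> card B = r}"
      unfolding eq by (rule card_image)
    also have "\<dots> = 2" using L A by (simp add: manifold_def pure_thin_def)
    finally show "card {B \<in> (`) f ` L. A' \<subseteq> B \<and> card B = r} = 2" .
  next
    fix G' assume "G' \<in> (`) f ` L" "G' \<noteq> {}"
    then obtain G where G: "G \<in> L" "G' = f ` G" "G \<noteq> {}" by auto
    have "link G L \<subseteq> Pow U" using manifold_link[OF L G(1)] by (simp add: manifold_def pure_thin_def)
    then show "sphere_like (f ` U) (r - card G') (link G' ((`) f ` L))"
      using sphere_like_image[OF inj _ manifold_sphere_like[OF L G(1,3)]] link_image[OF inj LU G(1)] crd[OF G(1)] G(2) by simp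
  qed
qed

section \<open>From two adjacent ranks down to the vertices\<close>

text \<open>Faces are ranked by their number of vertices.\<close>

definition ranks_map :: "nat \<Rightarrow> 'a set set \<Rightarrow> 'b set set \<Rightarrow> ('a set \<Rightarrow> 'b set) \<Rightarrow> bool" where
  "ranks_map j X Y \<phi> \<longleftrightarrow>
     (\<forall>A\<in>X. card A = j \<or> card A = Suc j \<longrightarrow> \<phi> A \<in> Y \<and> card (\<phi> A) = card A) \<and>
     (\<forall>A\<in>X. \<forall>B\<in>X. card A = j \<and> card B = Suc j \<and> A \<subseteq> B \<longrightarrow> \<phi> A \<subseteq> \<phi> B)"

definition ranks_iso :: "nat \<Rightarrow> 'a set set \<Rightarrow> 'b set set \<Rightarrow> ('a set \<Rightarrow> 'b set) \<Rightarrow> ('b set \<Rightarrow> 'a set) \<Rightarrow> bool" where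
  "ranks_iso j X Y \<phi> \<psi> \<longleftrightarrow> ranks_map j X Y \<phi> \<and> ranks_map j Y X \<psi> \<and>
     (\<forall>A\<in>X. card A = j \<or> card A = Suc j \<longrightarrow> \<psi> (\<phi> A) = A) \<and>
     (\<forall>B\<in>Y. card B = j \<or> card B = Suc j \<longrightarrow> \<phi> (\<psi> B) = B)"

lemma ranks_iso_sym: "ranks_iso j X Y \<phi> \<psi> \<Longrightarrow> ranks_iso j Y X \<psi> \<phi>"
  by (auto simp: ranks_iso_def)

lemma ranks_mapD:
  assumes "ranks_map j X Y \<phi>"
  shows "A \<in> X \<Longrightarrow> card A = j \<Longrightarrow> \<phi> A \<in> Y" "A \<in> X \<Longrightarrow> card A = j \<Longrightarrow> card (\<phi> A) = j"
    "A \<in> X \<Longrightarrow> card A = Suc j \<Longrightarrow> \<phi> A \<in> Y" "A \<in> X \<Longrightarrow> card A = Suc j \<Longrightarrow> card (\<phi> A) = Suc j"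
    "A \<in> X \<Longrightarrow> B \<in> X \<Longrightarrow> card A = j \<Longrightarrow> card B = Suc j \<Longrightarrow> A \<subseteq> B \<Longrightarrow> \<phi> A \<subseteq> \<phi> B"
  using assms by (auto simp: ranks_map_def)

text \<open>If \<open>{u} + {w}\<close> is the boundary of a sum of edges, then every edge of the sum has both or none of
  its ends in the connected component of \<open>u\<close>. So this component contains an even number of the points
  \<open>u\<close> and \<open>w\<close>.\<close>

lemma connected_if_one_cycles_bound:
  assumes L: "simplicial_complex L" "L \<subseteq> Pow U" "finite U"
    and bnd: "\<And>c. chain L 1 c \<Longrightarrow> boundary U c = (\<lambda>_. 0) \<Longrightarrow> bounds_in U L 1 c"
    and uw: "{u} \<in> L" "{w} \<in> L"
  shows "(u, w) \<in> {(a, b). {a, b} \<in> L \<and> a \<noteq> b}\<^sup>*"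
proof (cases "u = w")
  case False
  let ?E = "{(a, b). {a, b} \<in> L \<and> a \<noteq> b}"
  define K where "K = {x. (u, x) \<in> ?E\<^sup>*}"
  define c :: "'a set \<Rightarrow> bit" where "c = (\<lambda>A. if A = {u} \<or> A = {w} then 1 else 0)"
  have UU: "u \<in> U" "w \<in> U" using uw L by auto
  have ch: "chain L 1 c" using uw by (auto simp: chain_def c_def)
  have "boundary U c B = 0" for B
  proof (cases "B = {}")
    case True
    have "(\<Sum>v\<in>U. c {v}) = (\<Sum>v\<in>{u, w}. c {v})"
      by (rule sum.mono_neutral_right) (use L UU in \<open>auto simp: c_def\<close>)
    also have "\<dots> = 0" using False by (simp add: c_def)
    finally show ?thesis using True by (simp add: boundary_def)
  next
    case False
    then have "insert v B \<noteq> {u}" "insert v B \<noteq> {w}" if "v \<notin> B" for v using that by auto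
    then show ?thesis unfolding boundary_def c_def by (intro sum.neutral) auto
  qed
  then obtain e where e: "chain L (Suc 1) e" "boundary U e = c"
    using bnd[OF ch] by (auto simp: bounds_in_def)
  have step: "y \<in> K" if "x \<in> K" "e {x, y} \<noteq> 0" for x y
  proof -
    have "{x, y} \<in> L" "card {x, y} = 2" using e(1) that by (auto simp: chain_def)
    then have "(x, y) \<in> ?E" by (auto simp: card_2_iff doubleton_eq_iff)
    then show ?thesis using that(1) unfolding K_def by (simp add: rtrancl.rtrancl_into_rtrancl)
  qed
  have e1: "e {x} = 0" for x using e(1) by (auto simp: chain_def)
  \<comment> \<open>Both sums count the ends inside \<open>K\<close> of the edges of \<open>e\<close>; the right one counts every edge twice.\<close>
  have "(\<Sum>x\<in>K \<inter> U. c {x}) = (\<Sum>x\<in>K \<inter> U. \<Sum>y\<in>K \<inter> U. e {x, y})"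
  proof (rule sum.cong)
    fix x assume x: "x \<in> K \<inter> U"
    have "c {x} = (\<Sum>y\<in>U - {x}. e {x, y})" unfolding e(2)[symmetric] boundary_def by (simp add: insert_commute)
    also have "\<dots> = (\<Sum>y\<in>K \<inter> U. e {x, y})"
      using step[of x] x L(3) e1 by (intro sum.mono_neutral_cong) auto
    finally show "c {x} = (\<Sum>y\<in>K \<inter> U. e {x, y})" .
  qed simp
  also have "\<dots> = 0"
    by (rule sum_symmetric_bit) (use L e1 in \<open>auto simp: insert_commute\<close>)
  finally have s0: "(\<Sum>x\<in>K \<inter> U. c {x}) = 0" .
  have uK: "u \<in> K \<inter> U" using UU by (auto simp: K_def)
  have "w \<in> K"
  proof (rule ccontr)
    assume "w \<notin> K"
    then have "(\<Sum>x\<in>K \<inter> U. c {x}) = (\<Sum>x\<in>{u}. c {x})"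
      using uK L by (intro sum.mono_neutral_right) (auto simp: c_def)
    then show False using s0 by (simp add: c_def)
  qed
  then show ?thesis by (simp add: K_def)
qed simp

lemma manifold_link_connected:
  assumes L: "manifold U r L" and G: "G \<in> L" "G \<noteq> {}" "card G + 2 \<le> r"
    and uw: "{u} \<in> link G L" "{w} \<in> link G L"
  shows "(u, w) \<in> {(a, b). {a, b} \<in> link G L \<and> a \<noteq> b}\<^sup>*"
proof -
  have M: "manifold U (r - card G) (link G L)" by (rule manifold_link[OF L G(1)])
  show ?thesis
    by (rule connected_if_one_cycles_bound[of _ U]) 
      (use M uw G sphere_like_cycle_bounds[OF manifold_sphere_like[OF L G(1,2)]] in \<open>auto simp: manifold_def pure_thin_def\<close>)
qed

lemma manifold_extend:
  assumes L: "manifold U r L" and A: "A \<in> L" "card A \<le> s" "s \<le> r"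
  shows "\<exists>B\<in>L. A \<subseteq> B \<and> card B = s"
proof -
  obtain C where C: "C \<in> L" "A \<subseteq> C" "card C = r" using manifold_pure[OF L A(1)] by blast
  have fC: "finite C" using manifold_finite_face[OF L C(1)] .
  obtain B where "A \<subseteq> B" "B \<subseteq> C" "card B = s"
    using exists_subset_between[of A s C] C A fC by blast
  moreover from this have "B \<in> L" using complexD(1)[OF manifold_complex[OF L] C(1)] by blast
  ultimately show ?thesis by blast
qed

lemma inter_of_adjacent:
  assumes "card a = j" "card b = j" "finite D" "card D = Suc j" "a \<subseteq> D" "b \<subseteq> D" "a \<noteq> b"
  shows "card (a \<inter> b) = j - 1"
proof -
  have fin: "finite a" "finite b" using assms finite_subset by auto
  have "a \<subset> a \<union> b" using assms fin card_subset_eq[of a b] card_subset_eq[of b a] by blast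
  then have "j < card (a \<union> b)" using assms fin psubset_card_mono[of "a \<union> b" a] by auto
  moreover have "card (a \<union> b) \<le> Suc j" using assms card_mono[of D "a \<union> b"] by auto
  ultimately show ?thesis using card_Un_Int[OF fin] assms by linarith
qed

lemma inter_eq_of_adjacent:
  assumes "finite D" "card D = Suc j" "finite D'" "card D' = Suc j" "D \<noteq> D'"
    "a \<subseteq> D" "a \<subseteq> D'" "card a = j"
  shows "D \<inter> D' = a"
proof -
  have "D \<inter> D' \<noteq> D"
    using assms card_subset_eq[of D' D] by auto
  then have "card (D \<inter> D') < Suc j" using assms psubset_card_mono[of D "D \<inter> D'"] by auto
  then have "card (D \<inter> D') \<le> card a" using assms by simp
  then show ?thesis using assms card_seteq[of "D \<inter> D'" a] by auto
qed

text \<open>All pairs of adjacent faces that meet in \<open>G\<close> give the same intersection of images. Such a pair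
  is an edge of the link of \<open>G\<close>. Edges of a common triangle agree; around a vertex of the link one passes
  from edge to edge through triangles, because the link of that vertex is connected; and from vertex to
  vertex one passes because the link of \<open>G\<close> itself is connected.\<close>

lemma lower_rank_face:
  assumes X: "manifold U r X" and Y: "simplicial_complex Y" and j: "2 \<le> j" "j + 2 \<le> r"
    and \<phi>: "ranks_map j X Y \<phi>" and inj: "inj_on \<phi> {A \<in> X. card A = j}" "inj_on \<phi> {A \<in> X. card A = Suc j}"
    and G: "G \<in> X" "card G = j - 1"
  shows "\<exists>T. T \<in> Y \<and> card T = j - 1 \<and> (\<forall>A B. A \<in> X \<longrightarrow> B \<in> X \<longrightarrow> card A = j \<longrightarrow> card B = j \<longrightarrow>
    A \<inter> B = G \<longrightarrow> A \<union> B \<in> X \<longrightarrow> card (A \<union> B) = Suc j \<longrightarrow> \<phi> A \<inter> \<phi> B = T)"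
proof -
  have c: "simplicial_complex X" by (rule manifold_complex[OF X])
  have finG: "finite G" using complexD(2)[OF c G(1)] .
  have "G \<noteq> {}" using G j by auto
  note map = ranks_mapD[OF \<phi>]
  define P where "P = (\<lambda>u. \<phi> (insert u G))"
  define E where "E = {(a, b). {a, b} \<in> link G X \<and> a \<noteq> b}"
  have E: "(u, v) \<in> E \<longleftrightarrow> u \<noteq> v \<and> u \<notin> G \<and> v \<notin> G \<and> insert u (insert v G) \<in> X" for u v
    by (auto simp: E_def link_iff[OF c])
  have V: "{u} \<in> link G X \<longleftrightarrow> u \<notin> G \<and> insert u G \<in> X" for u
    by (auto simp: link_iff[OF c])
  have Esym: "(v, u) \<in> E" if "(u, v) \<in> E" for u v using that by (auto simp: E insert_commute)
  have EV: "{u} \<in> link G X" if "(u, v) \<in> E" for u v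
    unfolding V using that complexD(1)[OF c, of "insert u (insert v G)" "insert u G"] by (auto simp: E)
  have crd: "card (insert u G) = j" if "u \<notin> G" for u using that G finG j by simp
  have crd2: "card (insert u (insert v G)) = Suc j" if "u \<notin> G" "v \<notin> G" "u \<noteq> v" for u v
    using that G finG j by simp
  \<comment> \<open>Each of the three images is the intersection of two of the images \<open>D\<close> of the sides, so any two of
    them meet in the common intersection of the three sides.\<close>
  have tri: "P u \<inter> P v = P u \<inter> P w"
    if T: "u \<notin> G" "v \<notin> G" "w \<notin> G" "u \<noteq> v" "u \<noteq> w" "v \<noteq> w" "insert u (insert v (insert w G)) \<in> X" for u v w
  proof -
    define D where "D = (\<lambda>a b. \<phi> (insert a (insert b G)))"
    have XX: "insert u (insert v G) \<in> X" "insert u (insert w G) \<in> X" "insert v (insert w G) \<in> X"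
      using complexD(1)[OF c T(7)] by (meson insertI1 insert_mono insert_subsetI subset_insertI subset_insertI2)+
    have X1: "insert u G \<in> X" "insert v G \<in> X" "insert w G \<in> X"
      using complexD(1)[OF c T(7)] by (meson insert_subsetI insertI1 insertI2 subset_insertI2 subset_refl)+
    have cD: "card (D u v) = Suc j" "card (D u w) = Suc j" "card (D v w) = Suc j"
      unfolding D_def by (rule map(4), use XX crd2 T(1-6) in blast, use crd2 T(1-6) in blast)+
    have fD: "finite (D u v)" "finite (D u w)" "finite (D v w)"
      using cD by (metis card.infinite Zero_not_Suc)+
    have ne: "D u v \<noteq> D u w" "D u v \<noteq> D v w" "D u w \<noteq> D v w"
    proof -
      have "insert u (insert v G) \<noteq> insert u (insert w G)" "insert u (insert v G) \<noteq> insert v (insert w G)"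
        "insert u (insert w G) \<noteq> insert v (insert w G)" using T(1-6) by (metis insertCI insertE)+
      then show "D u v \<noteq> D u w" "D u v \<noteq> D v w" "D u w \<noteq> D v w"
        unfolding D_def using XX crd2 T(1-6) by (simp_all only: inj_on_eq_iff[OF inj(2)] mem_Collect_eq not_False_eq_True simp_thms)
    qed
    have P: "P u \<subseteq> D u v" "P u \<subseteq> D u w" "P v \<subseteq> D u v" "P v \<subseteq> D v w" "P w \<subseteq> D u w" "P w \<subseteq> D v w"
      unfolding P_def D_def by (rule map(5); use XX X1 crd crd2 T(1-6) in blast)+
    have cP: "card (P u) = j" "card (P v) = j" "card (P w) = j"
      unfolding P_def by (rule map(2); use X1 crd T(1-6) in blast)+
    have "D u v \<inter> D u w = P u" "D u v \<inter> D v w = P v" "D u w \<inter> D v w = P w"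
      using inter_eq_of_adjacent fD cD ne P cP by metis+
    then show ?thesis by blast
  qed
  have at_vertex: "P u \<inter> P v = P u \<inter> P w" if uv: "(u, v) \<in> E" and uw: "(u, w) \<in> E" for u v w
  proof -
    let ?L = "link (insert u G) X"
    have uG: "u \<notin> G" "insert u G \<in> X" using EV[OF uv] by (auto simp: V)
    have "{v} \<in> ?L" "{w} \<in> ?L" using uv uw by (auto simp: E link_iff[OF c] insert_commute)
    then have "(v, w) \<in> {(a, b). {a, b} \<in> ?L \<and> a \<noteq> b}\<^sup>*"
      using manifold_link_connected[OF X uG(2)] crd[OF uG(1)] j by auto
    then show ?thesis
    proof induction
      case (step y z)
      then have "P u \<inter> P y = P u \<inter> P z"
        using uG by (intro tri) (auto simp: link_iff[OF c] insert_commute)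
      then show ?case using step.IH by simp
    qed simp
  qed
  obtain u0 v0 where e0: "(u0, v0) \<in> E"
  proof -
    have "card G \<le> Suc j" "Suc j \<le> r" using G j by linarith+
    then obtain B where B: "B \<in> X" "G \<subseteq> B" "card B = Suc j" using manifold_extend[OF X G(1)] by blast
    have "finite B" using complexD(2)[OF c B(1)] .
    then have "card (B - G) = 2" using B G finG j by (simp add: card_Diff_subset)
    then obtain u v where uv: "B - G = {u, v}" "u \<noteq> v" by (auto simp: card_2_iff)
    then have "B = insert u (insert v G)" "u \<notin> G" "v \<notin> G" using B by auto
    then have "(u, v) \<in> E" using uv B by (auto simp: E)
    then show ?thesis using that by blast
  qed
  define T where "T = P u0 \<inter> P v0"
  have star: "P x \<inter> P y = T" if "(u0, x) \<in> E\<^sup>*" "(x, y) \<in> E" for x y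
    using that
  proof (induction arbitrary: y rule: rtrancl_induct)
    case base
    then show ?case unfolding T_def by (intro at_vertex e0)
  next
    case (step a b)
    have "P b \<inter> P y = P b \<inter> P a" using at_vertex[OF step.prems Esym[OF step.hyps(2)]] .
    also have "\<dots> = T" using step.IH[OF step.hyps(2)] by (simp add: Int_commute)
    finally show ?case .
  qed
  have all: "P x \<inter> P y = T" if "(x, y) \<in> E" for x y
  proof -
    have "(u0, x) \<in> E\<^sup>*" unfolding E_def
      using manifold_link_connected[OF X G(1) \<open>G \<noteq> {}\<close> _ EV[OF e0] EV[OF that]] G j by simp
    then show ?thesis using star that by blast
  qed
  have "T \<in> Y" "card T = j - 1"
  proof -
    have u: "u0 \<notin> G" "v0 \<notin> G" "u0 \<noteq> v0" "insert u0 (insert v0 G) \<in> X" using e0 by (auto simp: E)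
    have uX: "insert u0 G \<in> X" "insert v0 G \<in> X" using EV[OF e0] EV[OF Esym[OF e0]] by (auto simp: V)
    have PY: "P u0 \<in> Y" unfolding P_def using map(1) uX crd u by blast
    then show "T \<in> Y" using complexD(1)[OF Y PY] by (auto simp: T_def)
    let ?D = "\<phi> (insert u0 (insert v0 G))"
    have D: "card ?D = Suc j" using map(4) u crd2 by blast
    then have "finite ?D" by (metis card.infinite Zero_not_Suc)
    moreover have "P u0 \<subseteq> ?D" "P v0 \<subseteq> ?D" unfolding P_def
      by (rule map(5); use uX u crd crd2 in auto)+
    moreover have "insert u0 G \<noteq> insert v0 G" using u by auto
    then have "P u0 \<noteq> P v0" unfolding P_def using inj_onD[OF inj(1)] uX crd u by blast
    moreover have "card (P u0) = j" "card (P v0) = j" unfolding P_def using map(2) uX crd u by auto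
    ultimately show "card T = j - 1" unfolding T_def using D inter_of_adjacent by blast
  qed
  moreover have "\<phi> A \<inter> \<phi> B = T" if AB: "A \<in> X" "B \<in> X" "card A = j" "card B = j" "A \<inter> B = G"
      "A \<union> B \<in> X" "card (A \<union> B) = Suc j" for A B
  proof -
    have fin: "finite A" "finite B" using AB complexD(2)[OF c] by auto
    have "card (A - G) = 1" "card (B - G) = 1" using AB G j fin finG by (auto simp: card_Diff_subset)
    then obtain u v where "A - G = {u}" "B - G = {v}" by (auto simp: card_1_singleton_iff)
    then have uv: "A = insert u G" "B = insert v G" "u \<notin> G" "v \<notin> G" "u \<noteq> v" using AB(5) by auto
    then have "(u, v) \<in> E" using AB(6) by (auto simp: E insert_commute)
    then show ?thesis using all uv by (auto simp: P_def)
  qed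
  ultimately show ?thesis by blast
qed


lemma adjacent_face:
  assumes X: "manifold U r X" and A: "A \<in> X" "card A = j" "G \<subseteq> A" "card G = j - 1" and j: "1 \<le> j" "Suc j \<le> r"
  obtains B where "B \<in> X" "card B = j" "A \<inter> B = G" "A \<union> B \<in> X" "card (A \<union> B) = Suc j"
proof -
  have c: "simplicial_complex X" by (rule manifold_complex[OF X])
  obtain C where C: "C \<in> X" "A \<subseteq> C" "card C = Suc j" using manifold_extend[OF X A(1), of "Suc j"] A j by auto
  have fin: "finite A" "finite C" "finite G"
    using complexD(2)[OF c A(1)] complexD(2)[OF c C(1)] A(3) finite_subset by auto
  have "card (C - A) = 1" using C A fin by (simp add: card_Diff_subset)
  then obtain x where x: "C - A = {x}" by (auto simp: card_1_singleton_iff)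
  let ?B = "insert x G"
  have xG: "x \<notin> A" "x \<notin> G" using x A by auto
  have "?B \<subseteq> C" using x A C by auto
  then have "?B \<in> X" using complexD(1)[OF c C(1)] by blast
  moreover have "card ?B = j" using xG fin A j by simp
  moreover have "A \<inter> ?B = G" using xG A by auto
  moreover have "A \<union> ?B = C" using x A C by auto
  ultimately show ?thesis using that C by metis
qed

text \<open>The rule that forces the images \<open>T\<close> of the faces of rank \<open>j - 1\<close>.\<close>

definition inter_compatible ::
  "nat \<Rightarrow> 'a set set \<Rightarrow> ('a set \<Rightarrow> 'b set) \<Rightarrow> ('a set \<Rightarrow> 'b set) \<Rightarrow> bool" where
  "inter_compatible j X \<phi> T \<longleftrightarrow> (\<forall>A\<in>X. \<forall>B\<in>X.
     card A = j \<and> card B = j \<and> card (A \<inter> B) = j - 1 \<and> A \<union> B \<in> X \<and> card (A \<union> B) = Suc j \<longrightarrow>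
     T (A \<inter> B) = \<phi> A \<inter> \<phi> B)"

lemma inter_compatibleD:
  assumes "inter_compatible j X \<phi> T" "A \<in> X" "B \<in> X" "card A = j" "card B = j" "card (A \<inter> B) = j - 1"
    "A \<union> B \<in> X" "card (A \<union> B) = Suc j"
  shows "T (A \<inter> B) = \<phi> A \<inter> \<phi> B"
  using assms by (auto simp: inter_compatible_def)

lemma lower_ranks_map:
  assumes X: "manifold U r X" and Y: "simplicial_complex Y" and j: "2 \<le> j" "j + 2 \<le> r"
    and iso: "ranks_iso j X Y \<phi> \<psi>"
  obtains T where "\<And>G. G \<in> X \<Longrightarrow> card G = j - 1 \<Longrightarrow> T G \<in> Y \<and> card (T G) = j - 1"
    "inter_compatible j X \<phi> T"
proof -
  have c: "simplicial_complex X" by (rule manifold_complex[OF X])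
  have map: "ranks_map j X Y \<phi>" using iso by (simp add: ranks_iso_def)
  have inj: "inj_on \<phi> {A \<in> X. card A = j}" "inj_on \<phi> {A \<in> X. card A = Suc j}"
    using iso unfolding ranks_iso_def by (metis (mono_tags, lifting) inj_on_inverseI mem_Collect_eq)+
  define Q where "Q = (\<lambda>G T. T \<in> Y \<and> card T = j - 1 \<and>
    (\<forall>A B. A \<in> X \<longrightarrow> B \<in> X \<longrightarrow> card A = j \<longrightarrow> card B = j \<longrightarrow>
    A \<inter> B = G \<longrightarrow> A \<union> B \<in> X \<longrightarrow> card (A \<union> B) = Suc j \<longrightarrow> \<phi> A \<inter> \<phi> B = T))"
  have "\<exists>T. Q G T" if "G \<in> X" "card G = j - 1" for G
    unfolding Q_def by (rule lower_rank_face[OF X Y j map inj that])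
  then obtain T where T: "\<And>G. G \<in> X \<Longrightarrow> card G = j - 1 \<Longrightarrow> Q G (T G)" by metis
  show ?thesis
  proof (rule that[of T])
    show "T G \<in> Y \<and> card (T G) = j - 1" if "G \<in> X" "card G = j - 1" for G
      using T[OF that] by (simp add: Q_def)
    show "inter_compatible j X \<phi> T"
      unfolding inter_compatible_def
    proof (intro ballI impI)
      fix A B assume AB: "A \<in> X" "B \<in> X" "card A = j \<and> card B = j \<and> card (A \<inter> B) = j - 1 \<and>
        A \<union> B \<in> X \<and> card (A \<union> B) = Suc j"
      have "Q (A \<inter> B) (T (A \<inter> B))"
        using T complexD(1)[OF c AB(1), of "A \<inter> B"] AB by simp
      then show "T (A \<inter> B) = \<phi> A \<inter> \<phi> B" using AB by (simp add: Q_def)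
    qed
  qed
qed

text \<open>Write \<open>G\<close> as the intersection of two adjacent faces. Their images are adjacent too, so both
  intersection rules apply, and \<open>\<psi>\<close> undoes \<open>\<phi>\<close> on the two faces.\<close>

lemma lower_ranks_inverse:
  assumes X: "manifold U r X" and j: "2 \<le> j" "j + 2 \<le> r"
    and iso: "ranks_iso j X Y \<phi> \<psi>"
    and T: "inter_compatible j X \<phi> T"
    and S: "inter_compatible j Y \<psi> S"
    and G: "G \<in> X" "card G = j - 1"
  shows "S (T G) = G"
proof -
  obtain A where A: "A \<in> X" "G \<subseteq> A" "card A = j" using manifold_extend[OF X G(1), of j] G j by auto
  obtain B where B: "B \<in> X" "card B = j" "A \<inter> B = G" "A \<union> B \<in> X" "card (A \<union> B) = Suc j"
    using adjacent_face[OF X A(1,3,2) G(2)] j by auto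
  have map: "ranks_map j X Y \<phi>" using iso by (simp add: ranks_iso_def)
  note m = ranks_mapD[OF map]
  let ?D = "\<phi> (A \<union> B)"
  have D: "?D \<in> Y" "card ?D = Suc j" using m(3,4) B by auto
  have fD: "finite ?D" using D by (metis card.infinite Zero_not_Suc)
  have sub: "\<phi> A \<subseteq> ?D" "\<phi> B \<subseteq> ?D" using m(5) A B by auto
  have cA: "\<phi> A \<in> Y" "\<phi> B \<in> Y" "card (\<phi> A) = j" "card (\<phi> B) = j" using m(1,2) A B by auto
  have inv: "\<psi> (\<phi> A) = A" "\<psi> (\<phi> B) = B" using iso A B by (auto simp: ranks_iso_def)
  have "A \<noteq> B" using B by auto
  then have ne: "\<phi> A \<noteq> \<phi> B" using inv by metis
  have cI: "card (\<phi> A \<inter> \<phi> B) = j - 1" using inter_of_adjacent[OF cA(3,4) fD D(2) sub ne] .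
  have fin: "finite (\<phi> A)" "finite (\<phi> B)" using sub fD finite_subset by auto
  have "card (\<phi> A \<union> \<phi> B) = Suc j" using card_Un_Int[OF fin] cA cI j by simp
  then have U: "\<phi> A \<union> \<phi> B = ?D" using sub fD D by (intro card_subset_eq) auto
  have "T G = \<phi> A \<inter> \<phi> B" using inter_compatibleD[OF T A(1) B(1) A(3) B(2) _ B(4,5)] B(3) G by simp
  then have "S (T G) = \<psi> (\<phi> A) \<inter> \<psi> (\<phi> B)" using inter_compatibleD[OF S cA cI] D U by simp
  then show ?thesis using inv B by simp
qed

lemma lower_ranks_order:
  assumes X: "manifold U r X" and j: "2 \<le> j" "j + 2 \<le> r"
    and T: "inter_compatible j X \<phi> T"
    and G: "A \<in> X" "card A = j" "card G = j - 1" "G \<subseteq> A"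
  shows "T G \<subseteq> \<phi> A"
proof -
  obtain B where B: "B \<in> X" "card B = j" "A \<inter> B = G" "A \<union> B \<in> X" "card (A \<union> B) = Suc j"
    using adjacent_face[OF X G(1,2,4,3)] j by auto
  then have "T G = \<phi> A \<inter> \<phi> B" using inter_compatibleD[OF T G(1) B(1) G(2) B(2) _ B(4,5)] G by simp
  then show ?thesis by simp
qed

lemma lower_ranks:
  assumes X: "manifold U r X" and Y: "manifold U' r Y" and j: "2 \<le> j" "j + 2 \<le> r"
    and iso: "ranks_iso j X Y \<phi> \<psi>"
  obtains \<phi>' \<psi>' where "ranks_iso (j - 1) X Y \<phi>' \<psi>'" "\<And>A. card A = j \<Longrightarrow> \<phi>' A = \<phi> A"
proof -
  have cX: "simplicial_complex X" and cY: "simplicial_complex Y" by (rule manifold_complex[OF X], rule manifold_complex[OF Y])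
  note iso' = ranks_iso_sym[OF iso]
  obtain T where T: "\<And>G. G \<in> X \<Longrightarrow> card G = j - 1 \<Longrightarrow> T G \<in> Y \<and> card (T G) = j - 1"
    "inter_compatible j X \<phi> T"
    using lower_ranks_map[OF X cY j iso] by blast
  obtain S where S: "\<And>G. G \<in> Y \<Longrightarrow> card G = j - 1 \<Longrightarrow> S G \<in> X \<and> card (S G) = j - 1"
    "inter_compatible j Y \<psi> S"
    using lower_ranks_map[OF Y cX j iso'] by blast
  define \<phi>' where "\<phi>' = (\<lambda>A. if card A = j then \<phi> A else T A)"
  define \<psi>' where "\<psi>' = (\<lambda>A. if card A = j then \<psi> A else S A)"
  have jj: "Suc (j - 1) = j" "j - 1 \<noteq> j" using j by auto
  have m: "ranks_map j X Y \<phi>" "ranks_map j Y X \<psi>" using iso by (auto simp: ranks_iso_def)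
  have "ranks_map (j - 1) X Y \<phi>'"
    unfolding ranks_map_def jj
  proof (intro conjI ballI impI)
    fix A assume A: "A \<in> X" "card A = j - 1 \<or> card A = j"
    show "\<phi>' A \<in> Y" "card (\<phi>' A) = card A"
      using A T(1)[OF A(1)] ranks_mapD(1,2)[OF m(1) A(1)] by (auto simp: \<phi>'_def)
  next
    fix G A assume "G \<in> X" "A \<in> X" "card G = j - 1 \<and> card A = j \<and> G \<subseteq> A"
    then show "\<phi>' G \<subseteq> \<phi>' A"
      using lower_ranks_order[OF X j T(2)] jj(2) by (simp add: \<phi>'_def)
  qed
  moreover have "ranks_map (j - 1) Y X \<psi>'"
    unfolding ranks_map_def jj
  proof (intro conjI ballI impI)
    fix A assume A: "A \<in> Y" "card A = j - 1 \<or> card A = j"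
    show "\<psi>' A \<in> X" "card (\<psi>' A) = card A"
      using A S(1)[OF A(1)] ranks_mapD(1,2)[OF m(2) A(1)] by (auto simp: \<psi>'_def)
  next
    fix G A assume "G \<in> Y" "A \<in> Y" "card G = j - 1 \<and> card A = j \<and> G \<subseteq> A"
    then show "\<psi>' G \<subseteq> \<psi>' A"
      using lower_ranks_order[OF Y j S(2)] jj(2) by (simp add: \<psi>'_def)
  qed
  moreover have "\<psi>' (\<phi>' A) = A" if A: "A \<in> X" "card A = j - 1 \<or> card A = j" for A
  proof (cases "card A = j")
    case True
    then show ?thesis using ranks_mapD(2)[OF m(1) A(1)] iso A by (simp add: \<phi>'_def \<psi>'_def ranks_iso_def)
  next
    case False
    then have "card (T A) = j - 1" "card A = j - 1" using T(1) A by auto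
    then show ?thesis using lower_ranks_inverse[OF X j iso T(2) S(2) A(1)] False jj(2) by (simp add: \<phi>'_def \<psi>'_def)
  qed
  moreover have "\<phi>' (\<psi>' A) = A" if A: "A \<in> Y" "card A = j - 1 \<or> card A = j" for A
  proof (cases "card A = j")
    case True
    then show ?thesis using ranks_mapD(2)[OF m(2) A(1)] iso A by (simp add: \<phi>'_def \<psi>'_def ranks_iso_def)
  next
    case False
    then have "card (S A) = j - 1" "card A = j - 1" using S(1) A by auto
    then show ?thesis using lower_ranks_inverse[OF Y j iso' S(2) T(2) A(1)] False jj(2) by (simp add: \<phi>'_def \<psi>'_def)
  qed
  ultimately have "ranks_iso (j - 1) X Y \<phi>' \<psi>'" unfolding ranks_iso_def jj by blast
  then show ?thesis using that[of \<phi>' \<psi>'] by (simp add: \<phi>'_def)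
qed

text \<open>A face is covered by its facets, and comparing cardinalities turns the inclusion into equality.\<close>

lemma ranks_map_image_Suc:
  assumes c: "simplicial_complex X" and m: "ranks_map j X Y \<phi>" and j: "1 \<le> j"
    and inj: "inj_on f {v. {v} \<in> X}"
    and im: "\<And>A. A \<in> X \<Longrightarrow> card A = j \<Longrightarrow> \<phi> A = f ` A" and A: "A \<in> X" "card A = Suc j"
  shows "\<phi> A = f ` A"
proof -
  have fin: "finite A" using complexD(2)[OF c A(1)] .
  have "A \<subseteq> {v. {v} \<in> X}" using complexD(1)[OF c A(1)] by auto
  then have cf: "card (f ` A) = Suc j" using A inj inj_on_subset card_image by metis
  have cp: "card (\<phi> A) = Suc j" using ranks_mapD(4)[OF m A] .
  have "f ` A \<subseteq> \<phi> A"
  proof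
    fix y assume "y \<in> f ` A"
    then obtain x where x: "x \<in> A" "y = f x" by auto
    obtain B where B: "{x} \<subseteq> B" "B \<subseteq> A" "card B = j"
      using exists_subset_between[of "{x}" j A] A j x fin by auto
    have "B \<in> X" using complexD(1)[OF c A(1) B(2)] .
    then have "f ` B \<subseteq> \<phi> A" using ranks_mapD(5)[OF m _ A(1) _ A(2) B(2)] im B by metis
    then show "y \<in> \<phi> A" using x B by auto
  qed
  moreover have "finite (\<phi> A)" using cp by (metis card.infinite Zero_not_Suc)
  ultimately have "f ` A = \<phi> A" using cf cp by (intro card_subset_eq) auto
  then show ?thesis by simp
qed

text \<open>Descend by \<open>lower_ranks\<close> until the lower rank consists of the vertices.\<close>

lemma ranks_iso_vertex_map:
  assumes X: "manifold U r X" and Y: "manifold U' r Y" and j: "1 \<le> j" "j + 2 \<le> r"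
    and iso: "ranks_iso j X Y \<phi> \<psi>"
  shows "\<exists>f. bij_betw f {v. {v} \<in> X} {w. {w} \<in> Y} \<and>
    (\<forall>A\<in>X. card A = j \<or> card A = Suc j \<longrightarrow> \<phi> A = f ` A)"
  using j iso
proof (induction j arbitrary: \<phi> \<psi> rule: nat_induct_at_least)
  case base
  have cX: "simplicial_complex X" by (rule manifold_complex[OF X])
  have m: "ranks_map 1 X Y \<phi>" "ranks_map 1 Y X \<psi>" using base by (auto simp: ranks_iso_def)
  define f where "f = (\<lambda>v. the_elem (\<phi> {v}))"
  define g where "g = (\<lambda>v. the_elem (\<psi> {v}))"
  have f: "\<phi> {v} = {f v}" "{f v} \<in> Y" if "{v} \<in> X" for v
  proof -
    have "card (\<phi> {v}) = 1" using ranks_mapD(2)[OF m(1) that] by simp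
    then obtain x where "\<phi> {v} = {x}" by (rule card_1_singletonE)
    then show "\<phi> {v} = {f v}" by (simp add: f_def)
    then show "{f v} \<in> Y" using ranks_mapD(1)[OF m(1) that] by simp
  qed
  have g: "\<psi> {v} = {g v}" "{g v} \<in> X" if "{v} \<in> Y" for v
  proof -
    have "card (\<psi> {v}) = 1" using ranks_mapD(2)[OF m(2) that] by simp
    then obtain x where "\<psi> {v} = {x}" by (rule card_1_singletonE)
    then show "\<psi> {v} = {g v}" by (simp add: g_def)
    then show "{g v} \<in> X" using ranks_mapD(1)[OF m(2) that] by simp
  qed
  have "{g (f v)} = {v}" if "{v} \<in> X" for v
  proof -
    have "\<psi> (\<phi> {v}) = {v}" using base that by (auto simp: ranks_iso_def)
    then show ?thesis using f[OF that] g[of "f v"] by simp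
  qed
  moreover have "{f (g v)} = {v}" if "{v} \<in> Y" for v
  proof -
    have "\<phi> (\<psi> {v}) = {v}" using base that by (auto simp: ranks_iso_def)
    then show ?thesis using g[OF that] f[of "g v"] by simp
  qed
  ultimately have bij: "bij_betw f {v. {v} \<in> X} {w. {w} \<in> Y}"
    using f(2) g(2) by (intro bij_betw_byWitness[where f' = g]) auto
  have 1: "\<phi> A = f ` A" if "A \<in> X" "card A = 1" for A
    using that f(1) by (auto simp: card_1_singleton_iff)
  have "\<phi> A = f ` A" if "A \<in> X" "card A = Suc 1" for A
    by (rule ranks_map_image_Suc[OF cX m(1) order_refl bij_betw_imp_inj_on[OF bij] 1 that])
  then show ?case using bij 1 by blast
next
  case (Suc j)
  have cX: "simplicial_complex X" by (rule manifold_complex[OF X])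
  have m: "ranks_map (Suc j) X Y \<phi>" using Suc.prems by (simp add: ranks_iso_def)
  obtain \<phi>' \<psi>' where l: "ranks_iso (Suc j - 1) X Y \<phi>' \<psi>'" "\<And>A. card A = Suc j \<Longrightarrow> \<phi>' A = \<phi> A"
    using lower_ranks[OF X Y _ Suc.prems] Suc.hyps by auto
  then obtain f where f: "bij_betw f {v. {v} \<in> X} {w. {w} \<in> Y}"
    "\<forall>A\<in>X. card A = j \<or> card A = Suc j \<longrightarrow> \<phi>' A = f ` A"
    using Suc.IH[of \<phi>' \<psi>'] Suc.prems by auto
  have 1: "\<phi> A = f ` A" if "A \<in> X" "card A = Suc j" for A using f(2) l(2) that by auto
  have "\<phi> A = f ` A" if "A \<in> X" "card A = Suc (Suc j)" for A
    by (rule ranks_map_image_Suc[OF cX m _ bij_betw_imp_inj_on[OF f(1)] 1 that]) simp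
  then show ?case using f(1) 1 by blast
qed

text \<open>By purity every face with at most \<open>Suc j\<close> vertices lies in one with exactly \<open>Suc j\<close> vertices.\<close>

lemma ranks_iso_skeleton:
  assumes X: "manifold U r X" and Y: "manifold U' r Y" and j: "1 \<le> j" "j + 2 \<le> r"
    and iso: "ranks_iso j X Y \<phi> \<psi>"
  obtains f where "bij_betw f {v. {v} \<in> X} {w. {w} \<in> Y}"
    "\<And>A. A \<in> X \<Longrightarrow> card A = j \<or> card A = Suc j \<Longrightarrow> \<phi> A = f ` A"
    "\<And>A. A \<subseteq> {v. {v} \<in> X} \<Longrightarrow> card A \<le> Suc j \<Longrightarrow> A \<in> X \<longleftrightarrow> f ` A \<in> Y"
proof -
  have cX: "simplicial_complex X" and cY: "simplicial_complex Y" by (rule manifold_complex[OF X], rule manifold_complex[OF Y])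
  obtain f where f: "bij_betw f {v. {v} \<in> X} {w. {w} \<in> Y}"
    "\<And>A. A \<in> X \<Longrightarrow> card A = j \<or> card A = Suc j \<Longrightarrow> \<phi> A = f ` A"
    using ranks_iso_vertex_map[OF X Y j iso] by blast
  have m: "ranks_map j X Y \<phi>" "ranks_map j Y X \<psi>" using iso by (auto simp: ranks_iso_def)
  have "A \<in> X \<longleftrightarrow> f ` A \<in> Y" if A: "A \<subseteq> {v. {v} \<in> X}" "card A \<le> Suc j" for A
  proof
    assume "A \<in> X"
    then obtain B where B: "B \<in> X" "A \<subseteq> B" "card B = Suc j" using manifold_extend[OF X _ A(2)] j by auto
    then have "f ` B \<in> Y" using ranks_mapD(3)[OF m(1)] f(2) by metis
    then show "f ` A \<in> Y" using complexD(1)[OF cY _ image_mono[OF B(2)]] by blast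
  next
    assume fA: "f ` A \<in> Y"
    have "card (f ` A) \<le> Suc j" using A f(1) by (metis bij_betw_def card_image inj_on_subset)
    then obtain B where B: "B \<in> Y" "f ` A \<subseteq> B" "card B = Suc j" using manifold_extend[OF Y fA, of "Suc j"] j by auto
    have C: "\<psi> B \<in> X" "card (\<psi> B) = Suc j" using ranks_mapD(3,4)[OF m(2)] B by auto
    have "f ` \<psi> B = B" using f(2)[OF C(1)] C(2) iso B by (auto simp: ranks_iso_def)
    then have "f ` A \<subseteq> f ` \<psi> B" using B by simp
    moreover have "\<psi> B \<subseteq> {v. {v} \<in> X}" using complexD(1)[OF cX C(1)] by auto
    ultimately have "A \<subseteq> \<psi> B" using A(1) subset_if_image_subset[OF bij_betw_imp_inj_on[OF f(1)]] by blast
    then show "A \<in> X" using complexD(1)[OF cX C(1)] by blast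
  qed
  then show ?thesis using that f by blast
qed

section \<open>Homology groups and bounding cycles\<close>

lemma mem_faces: "A \<in> faces (int j - 1) X \<longleftrightarrow> A \<in> X \<and> card A = j"
  by (simp add: faces_def face_dim_def)

text \<open>Only chains of vertices reach the empty face.\<close>

lemma boundary_at_empty_face: "chain L j e \<Longrightarrow> j \<noteq> 1 \<Longrightarrow> boundary U e {} = 0"
  by (auto simp: boundary_def chain_def intro!: sum.neutral)

lemma carrier_chain_group:
  "1 \<le> j \<Longrightarrow> c \<in> carrier (Z2_chain_group (int j - 1) L) \<longleftrightarrow> chain L j c"
  by (auto simp: Z2_chain_group_def chain_def mem_faces)

lemma Z2_boundary_eq:
  assumes c: "simplicial_complex L" and LU: "L \<subseteq> Pow U" and U: "finite U" and ch: "chain L j e"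
  shows "Z2_boundary (int j - 1) L e B = (if B = {} then 0 else boundary U e B)"
proof (cases "B \<in> L \<and> Suc (card B) = j")
  case True
  have B: "B \<in> faces (int j - 1 - 1) L" using True by (auto simp: faces_def face_dim_def)
  have fB: "finite B" using True complexD(2)[OF c] by blast
  have "boundary U e B = (\<Sum>v\<in>{v \<in> U - B. insert v B \<in> L}. e (insert v B))"
    unfolding boundary_def using ch U by (intro sum.mono_neutral_right) (auto simp: chain_def)
  also have "\<dots> = (\<Sum>A\<in>{A \<in> L. B \<subseteq> A \<and> card A = Suc (card B)}. e A)"
    by (rule sum.reindex_bij_betw[OF cofaces_bij[OF c LU fB]])
  also have "{A \<in> L. B \<subseteq> A \<and> card A = Suc (card B)} = {A \<in> faces (int j - 1) L. B \<subseteq> A}"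
    using True by (auto simp: mem_faces)
  finally show ?thesis using B by (simp add: Z2_boundary_def)
next
  case False
  have "e (insert v B) = 0" if "v \<notin> B" for v
  proof (rule ccontr)
    assume "e (insert v B) \<noteq> 0"
    then have *: "insert v B \<in> L" "card (insert v B) = j" using ch by (auto simp: chain_def)
    then have "B \<in> L" "finite B" using complexD(1)[OF c *(1)] complexD(2)[OF c *(1)] by auto
    then show False using False * that by auto
  qed
  then have "boundary U e B = 0" by (simp add: boundary_def)
  moreover have "Z2_boundary (int j - 1) L e B = 0"
    using False by (auto simp: Z2_boundary_def faces_def face_dim_def)
  ultimately show ?thesis by simp
qed

text \<open>Cycles of unreduced homology are only tested on nonempty faces. Boundaries in degree at least \<open>1\<close>
  come from faces with at least two vertices, for which reduced and unreduced boundary agree.\<close>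

lemma homology_carrier:
  assumes c: "simplicial_complex L" and LU: "L \<subseteq> Pow U" and U: "finite U" and j: "1 \<le> j"
  shows "carrier (Z2_homology (int j - 1) L) =
    (\<lambda>z. {\<lambda>A. b A + z A |b. bounds_in U L j b}) ` {z. chain L j z \<and> (\<forall>B. B \<noteq> {} \<longrightarrow> boundary U z B = 0)}"
proof -
  note bdry = Z2_boundary_eq[OF c LU U]
  have cyc: "Z2_cycles (int j - 1) L = {z. chain L j z \<and> (\<forall>B. B \<noteq> {} \<longrightarrow> boundary U z B = 0)}"
  proof -
    have "Z2_boundary (int j - 1) L z = (\<lambda>_. 0) \<longleftrightarrow> (\<forall>B. B \<noteq> {} \<longrightarrow> boundary U z B = 0)" if "chain L j z" for z
      unfolding fun_eq_iff bdry[OF that] by auto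
    moreover have "\<one>\<^bsub>Z2_chain_group (int j - 1 - 1) L\<^esub> = (\<lambda>_. 0)" by (simp add: Z2_chain_group_def)
    ultimately show ?thesis
      unfolding Z2_cycles_def kernel_def by (auto simp: carrier_chain_group[OF j])
  qed
  have bnd: "Z2_boundaries (int j - 1) L = {b. bounds_in U L j b}"
  proof -
    have "Z2_boundary (int j - 1 + 1) L e = boundary U e" if "chain L (Suc j) e" for e
      using bdry[OF that] boundary_at_empty_face[OF that, of U] j by (auto simp: fun_eq_iff)
    moreover have "carrier (Z2_chain_group (int j - 1 + 1) L) = {e. chain L (Suc j) e}"
      using carrier_chain_group[of "Suc j" _ L] by auto
    ultimately show ?thesis unfolding Z2_boundaries_def bounds_in_def by force
  qed
  show ?thesis
    unfolding Z2_homology_def FactGroup_def RCOSETS_def r_coset_def cyc bnd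
    by (auto simp: Z2_chain_group_def)
qed

lemma coset_in_homology:
  assumes "simplicial_complex L" "L \<subseteq> Pow U" "finite U" "1 \<le> j"
    and "chain L j z" "\<And>B. B \<noteq> {} \<Longrightarrow> boundary U z B = 0"
  shows "{\<lambda>A. b A + z A |b. bounds_in U L j b} \<in> carrier (Z2_homology (int j - 1) L)"
  unfolding homology_carrier[OF assms(1-4)] by (rule imageI) (use assms in simp)

lemma boundary_coset_eqD:
  assumes "{\<lambda>A. b A + z A |b. bounds_in U L j b} = {\<lambda>A. b A + z' A |b. bounds_in U L j b}"
  shows "bounds_in U L j (\<lambda>A. z A + z' A)"
proof -
  have "z \<in> {\<lambda>A. b A + z A |b. bounds_in U L j b}"
    using bounds_zero[of U L j] by (auto intro!: exI[of _ "\<lambda>_. 0"])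
  then obtain b where b: "bounds_in U L j b" "z = (\<lambda>A. b A + z' A)" using assms by auto
  have "(\<lambda>A. z A + z' A) = b" unfolding b(2) by (simp add: fun_eq_iff add.assoc)
  then show ?thesis using b by simp
qed

lemma trivial_homology_bounds:
  assumes c: "simplicial_complex L" and LU: "L \<subseteq> Pow U" and U: "finite U" and j: "1 \<le> j"
    and H: "trivial_group (Z2_homology (int j - 1) L)"
    and z: "chain L j z" "boundary U z = (\<lambda>_. 0)"
  shows "bounds_in U L j z"
proof -
  let ?C = "\<lambda>z. {\<lambda>A. b A + z A |b. bounds_in U L j b}"
  have "?C z \<in> carrier (Z2_homology (int j - 1) L)" "?C (\<lambda>_. 0) \<in> carrier (Z2_homology (int j - 1) L)"
    by (rule coset_in_homology[OF c LU U j]; use z in simp)+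
  then have "?C z = ?C (\<lambda>_. 0)" using H by (auto simp: trivial_group_def)
  then show ?thesis using boundary_coset_eqD by fastforce
qed

lemma homology_Z2_card:
  assumes "H \<cong> integer_mod_group 2"
  shows "card (carrier H) = 2"
proof -
  obtain h where "bij_betw h (carrier H) (carrier (integer_mod_group 2))"
    using assms by (auto simp: is_iso_def iso_def)
  then have "card (carrier H) = card (carrier (integer_mod_group 2))" by (rule bij_betw_same_card)
  then show ?thesis by (simp add: carrier_integer_mod_group)
qed

text \<open>The classes of \<open>0\<close>, \<open>x\<close> and \<open>y\<close> cannot be distinct in a group with two elements.\<close>

lemma two_cosets:
  assumes c: "simplicial_complex L" and LU: "L \<subseteq> Pow U" and U: "finite U" and j: "1 \<le> j"
    and H: "Z2_homology (int j - 1) L \<cong> integer_mod_group 2"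
    and x: "chain L j x" "\<And>B. B \<noteq> {} \<Longrightarrow> boundary U x B = 0"
    and y: "chain L j y" "\<And>B. B \<noteq> {} \<Longrightarrow> boundary U y B = 0"
  shows "bounds_in U L j x \<or> bounds_in U L j y \<or> bounds_in U L j (\<lambda>A. x A + y A)"
proof (rule ccontr)
  let ?C = "\<lambda>z. {\<lambda>A. b A + z A |b. bounds_in U L j b}"
  assume neg: "\<not> ?thesis"
  have "?C (\<lambda>_. 0) \<noteq> ?C x" "?C (\<lambda>_. 0) \<noteq> ?C y" "?C x \<noteq> ?C y"
    using neg boundary_coset_eqD[where z = "\<lambda>_. 0" and z' = x] boundary_coset_eqD[where z = "\<lambda>_. 0" and z' = y]
      boundary_coset_eqD[where z = x and z' = y] by auto
  then have three: "card {?C (\<lambda>_. 0), ?C x, ?C y} = 3" by simp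
  have "?C (\<lambda>_. 0) \<in> carrier (Z2_homology (int j - 1) L)"
    by (rule coset_in_homology[OF c LU U j]) simp_all
  then have sub: "{?C (\<lambda>_. 0), ?C x, ?C y} \<subseteq> carrier (Z2_homology (int j - 1) L)"
    using coset_in_homology[OF c LU U j x] coset_in_homology[OF c LU U j y] by (intro insert_subsetI) simp_all
  have two: "card (carrier (Z2_homology (int j - 1) L)) = 2" by (rule homology_Z2_card[OF H])
  then have "finite (carrier (Z2_homology (int j - 1) L))" by (intro card_ge_0_finite) simp
  from card_mono[OF this sub] two three show False by linarith
qed

lemma chain_one_boundary: "chain L 1 y \<Longrightarrow> B \<noteq> {} \<Longrightarrow> boundary U y B = 0"
  unfolding boundary_def
proof (rule sum.neutral, rule ballI, rule ccontr)
  fix v assume y: "chain L 1 y" "B \<noteq> {}" "v \<in> U - B" "y (insert v B) \<noteq> 0"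
  then have "card (insert v B) = 1" by (auto simp: chain_def)
  then obtain w where "insert v B = {w}" by (rule card_1_singletonE)
  then show False using y by auto
qed

lemma bounding_zero_chain_even:
  assumes "finite U" "bounds_in U L 1 b" shows "boundary U b {} = 0"
proof -
  obtain e where e: "chain L (Suc 1) e" "boundary U e = b" using assms by (auto simp: bounds_in_def)
  have e1: "e {x} = 0" for x using e(1) by (auto simp: chain_def)
  have "boundary U b {} = (\<Sum>v\<in>U. \<Sum>w\<in>U - {v}. e {v, w})"
    unfolding e(2)[symmetric] by (simp add: boundary_def insert_commute)
  also have "\<dots> = (\<Sum>v\<in>U. \<Sum>w\<in>U. e {v, w})"
    using assms(1) e1 by (intro sum.cong sum.mono_neutral_left) auto
  also have "\<dots> = 0" by (rule sum_symmetric_bit) (use assms(1) e1 in \<open>auto simp: insert_commute\<close>)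
  finally show ?thesis .
qed

lemma vertex_chain:
  assumes "finite U" "v \<in> U" "{v} \<in> L"
  shows "chain L 1 (\<lambda>A. if A = {v} then 1 else 0)"
    "boundary U (\<lambda>A. if A = {v} then 1 else 0) = (\<lambda>A. if A = {} then 1 else 0)"
proof -
  show ch: "chain L 1 (\<lambda>A. if A = {v} then 1 else 0)" using assms by (simp add: chain_def)
  have "(\<Sum>w\<in>U. if {w} = {v} then 1 else 0) = (1 :: bit)" using assms by simp
  then show "boundary U (\<lambda>A. if A = {v} then 1 else 0) = (\<lambda>A. if A = {} then 1 else 0)"
    using chain_one_boundary[OF ch, of _ U] by (auto simp: fun_eq_iff boundary_def)
qed

lemma bit_eq_if_sum_zero: "(x::bit) + y = 0 \<Longrightarrow> x = y"
  by (cases x; cases y) auto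

lemma bit_one: "(x::bit) \<noteq> 0 \<Longrightarrow> x = 1"
  by (cases x) auto

text \<open>In degree \<open>1\<close>, a single vertex is not homologous to zero for reasons of parity, so one of the two
  classes is odd, and an even cycle has to be trivial. In the top degree nothing bounds except zero, so
  there are exactly two cycles, one of them the fundamental cycle. For \<open>r = 1\<close> the ridge condition at the empty face
  says that there are two points, which is a sphere of dimension \<open>0\<close>.\<close>

lemma sphere_like_of_homology:
  assumes L: "pure_thin U r L" and H: "has_Z2_homology_of_sphere (int r - 1) L"
  shows "sphere_like U r L"
  unfolding sphere_like_def
proof (intro allI impI, elim conjE, intro conjI impI)
  have c: "simplicial_complex L" and LU: "L \<subseteq> Pow U" and U: "finite U" using L by (auto simp: pure_thin_def)
  fix j z assume z: "chain L j z" "boundary U z = (\<lambda>_. 0)"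
  have zB: "\<And>B. B \<noteq> {} \<Longrightarrow> boundary U z B = 0" using z by simp
  have z0: "z A = 0" if "j = 0" "A \<noteq> {}" for A
    using z(1) that complexD(2)[OF c, of A] by (cases "z A = 0") (auto simp: chain_def)
  have vert: "\<exists>v. {v} \<in> L \<and> v \<in> U" if "0 < r"
  proof -
    obtain B where B: "B \<in> L" "card B = r" using pure_thin_pure[OF L complexD(3)[OF c]] by blast
    then have "B \<noteq> {}" using that by auto
    then obtain v where "v \<in> B" by blast
    then show ?thesis using complexD(1)[OF c B(1), of "{v}"] LU B by auto
  qed
  {
    assume j: "j < r"
    then obtain v where v: "{v} \<in> L" "v \<in> U" using vert by auto
    note vc = vertex_chain[OF U v(2,1)]
    consider "j = 0" | "j = 1" | "2 \<le> j" by linarith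
    then show "bounds_in U L j z"
    proof cases
      case 1
      show ?thesis
      proof (cases "z {} = 0")
        case True
        have "z = (\<lambda>_. 0)" using z0[OF 1] True by metis
        then show ?thesis by (simp add: bounds_zero)
      next
        case False
        then have "z {} = 1" by (rule bit_one)
        then have "z = (\<lambda>A. if A = {} then 1 else 0)" using z0[OF 1] by metis
        then show ?thesis using vc 1 by (auto simp: bounds_in_def)
      qed
    next
      case 2
      let ?y = "\<lambda>A. if A = {v} then 1 else (0::bit)"
      have "Z2_homology (int 1 - 1) L \<cong> integer_mod_group 2"
        using H j 2 by (simp add: has_Z2_homology_of_sphere_def)
      from two_cosets[OF c LU U order_refl this z(1)[unfolded 2] zB vc(1) chain_one_boundary[OF vc(1)]]
      consider "bounds_in U L 1 z" | "bounds_in U L 1 ?y" | "bounds_in U L 1 (\<lambda>A. z A + ?y A)" by blast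
      then show ?thesis
      proof cases
        case 2 then show ?thesis using bounding_zero_chain_even[OF U 2] vc(2) by simp
      next
        case 3
        then have "boundary U (\<lambda>A. z A + ?y A) {} = 0" by (rule bounding_zero_chain_even[OF U])
        then show ?thesis unfolding boundary_add vc(2) z(2) by simp
      qed (use 2 in simp)
    next
      case 3
      have "\<forall>i\<in>{1..int r - 1 - 1}. trivial_group (Z2_homology i L)"
        using H j 3 by (simp add: has_Z2_homology_of_sphere_def)
      moreover have "int j - 1 \<in> {1..int r - 1 - 1}" using j 3 by simp
      ultimately have "trivial_group (Z2_homology (int j - 1) L)" by blast
      then show ?thesis using trivial_homology_bounds[OF c LU U _ _ z] 3 by simp
    qed
  }
  {
    assume j: "j = r"
    consider "r = 0" | "r = 1" | "2 \<le> r" by linarith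
    then show "z = (\<lambda>_. 0) \<or> z = facet_chain r L"
    proof cases
      case 1
      have "facet_chain r L A = (if A = {} then 1 else 0)" for A
        using 1 complexD(2,3)[OF c] by (auto simp: facet_chain_def)
      moreover have "z = (\<lambda>_. 0)" if "z {} = 0" using z0 j 1 that by metis
      moreover have "z A = (if A = {} then 1 else 0)" if "z {} \<noteq> 0" for A using z0 j 1 bit_one[OF that] by simp
      ultimately show ?thesis by (metis ext)
    next
      case 2
      have b: "bij_betw (\<lambda>v. insert v {}) {v \<in> U - {}. insert v {} \<in> L} {A \<in> L. {} \<subseteq> A \<and> card A = Suc (card ({} :: 'a set))}"
        by (rule cofaces_bij[OF c LU]) simp
      have "card {A \<in> L. {} \<subseteq> A \<and> card A = r} = 2"
      proof -
        have "\<forall>A\<in>L. Suc (card A) = r \<longrightarrow> card {B \<in> L. A \<subseteq> B \<and> card B = r} = 2"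
          using L unfolding pure_thin_def by (elim conjE)
        from bspec[OF this complexD(3)[OF c]] show ?thesis using 2 by simp
      qed
      then have "card {v \<in> U. {v} \<in> L} = 2" using bij_betw_same_card[OF b] 2 by simp
      then obtain a b where ab: "{v \<in> U. {v} \<in> L} = {a, b}" "a \<noteq> b" by (auto simp: card_2_iff)
      have "0 = (\<Sum>v\<in>U. z {v})" using fun_cong[OF z(2), of "{}"] by (simp add: boundary_def)
      also have "\<dots> = (\<Sum>v\<in>{v \<in> U. {v} \<in> L}. z {v})"
        using z(1) U by (intro sum.mono_neutral_right) (auto simp: chain_def)
      also have "\<dots> = z {a} + z {b}" using ab by simp
      finally have zab: "z {a} = z {b}" using bit_eq_if_sum_zero by metis
      have out: "z A = (if A \<in> L \<and> card A = r then z {a} else 0)" for A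
      proof (cases "A \<in> L \<and> card A = r")
        case True
        then obtain v where v: "A = {v}" using 2 by (auto simp: card_1_singleton_iff)
        then have "v \<in> {v \<in> U. {v} \<in> L}" using True LU by auto
        then have "v = a \<or> v = b" using ab by auto
        then show ?thesis using True v zab by auto
      next
        case False then show ?thesis using z(1) j unfolding chain_def by auto
      qed
      show ?thesis
      proof (cases "z {a} = 0")
        case True then show ?thesis using out by (auto simp: fun_eq_iff)
      next
        case False
        then have "z {a} = 1" by (rule bit_one)
        then show ?thesis using out by (auto simp: fun_eq_iff facet_chain_def)
      qed
    next
      case 3
      have top: "b = (\<lambda>_. 0)" if b: "bounds_in U L r b" for b
      proof -
        obtain e where e: "chain L (Suc r) e" "boundary U e = b" using b by (auto simp: bounds_in_def)
        have "e A = 0" for A using e(1) pure_thin_card_le[OF L, of A] unfolding chain_def by fastforce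
        then have "e = (\<lambda>_. 0)" by blast
        then show ?thesis using e(2) by auto
      qed
      have H': "Z2_homology (int r - 1) L \<cong> integer_mod_group 2"
        using H 3 by (simp add: has_Z2_homology_of_sphere_def)
      have fB: "\<And>B. B \<noteq> {} \<Longrightarrow> boundary U (facet_chain r L) B = 0" using facet_chain_cycle[OF L] by simp
      have r1: "1 \<le> r" using 3 by simp
      obtain B where B: "B \<in> L" "card B = r" using pure_thin_pure[OF L complexD(3)[OF c]] by blast
      then have "facet_chain r L B = 1" by (simp add: facet_chain_def)
      then have ne: "facet_chain r L \<noteq> (\<lambda>_. 0)" by auto
      from two_cosets[OF c LU U r1 H' z(1)[unfolded j] zB chain_facet_chain fB]
      consider "z = (\<lambda>_. 0)" | "(\<lambda>A. z A + facet_chain r L A) = (\<lambda>_. 0)" using top ne by blast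
      then show ?thesis
      proof cases
        case 2
        then have "z A = facet_chain r L A" for A by (metis bit_eq_if_sum_zero)
        then show ?thesis by blast
      qed simp
    qed
  }
qed

lemma manifold_of_homology_manifold:
  assumes X: "homology_manifold (int r - 1) X"
  shows "manifold (\<Union>X) r X"
proof -
  have pm: "pseudomanifold (int r - 1) X" using X by (simp add: homology_manifold_def)
  have c: "simplicial_complex X" using pm by (simp add: pseudomanifold_def)
  have P: "pure_thin (\<Union>X) r X"
    unfolding pure_thin_def
  proof (intro conjI ballI impI)
    show "finite (\<Union>X)" using complexD(2,4)[OF c] by blast
    show "\<exists>B\<in>X. A \<subseteq> B \<and> card B = r" if "A \<in> X" for A
    proof -
      have "\<forall>A\<in>X. \<exists>B\<in>faces (int r - 1) X. A \<subseteq> B" using pm unfolding pseudomanifold_def by (elim conjE)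
      then have "\<exists>B\<in>faces (int r - 1) X. A \<subseteq> B" using \<open>A \<in> X\<close> by (rule bspec)
      then obtain B where "B \<in> faces (int r - 1) X" "A \<subseteq> B" by blast
      then show ?thesis using mem_faces[of B r X] by blast
    qed
    fix A assume A: "A \<in> X" "Suc (card A) = r"
    then have "A \<in> faces (int r - 1 - 1) X" by (auto simp: faces_def face_dim_def)
    then have "card {B \<in> faces (int r - 1) X. A \<subseteq> B} = 2" using pm by (simp add: pseudomanifold_def)
    moreover have "{B \<in> faces (int r - 1) X. A \<subseteq> B} = {B \<in> X. A \<subseteq> B \<and> card B = r}"
      by (auto simp: mem_faces)
    ultimately show "card {B \<in> X. A \<subseteq> B \<and> card B = r} = 2" by simp
  qed (use c in auto)
  have "sphere_like (\<Union>X) (r - card G) (link G X)" if G: "G \<in> X" "G \<noteq> {}" for G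
  proof (rule sphere_like_of_homology)
    show "pure_thin (\<Union>X) (r - card G) (link G X)" by (rule pure_thin_link[OF P G(1)])
    have g: "card G \<le> r" "1 \<le> card G" using pure_thin_card_le[OF P G(1)] G complexD(2)[OF c G(1)]
      by (auto simp: Suc_le_eq card_gt_0_iff)
    show "has_Z2_homology_of_sphere (int (r - card G) - 1) (link G X)"
    proof (cases "card G = r")
      case True then show ?thesis by (simp add: has_Z2_homology_of_sphere_def)
    next
      case False
      then have k: "int (card G) - 1 \<in> {0..(int r - 1) - 1}" "G \<in> faces (int (card G) - 1) X"
        using g G by (auto simp: mem_faces)
      have "\<forall>k\<in>{0..(int r - 1) - 1}. \<forall>G\<in>faces k X. has_Z2_homology_of_sphere (int r - 1 - k - 1) (link G X)"
        using X unfolding homology_manifold_def by (elim conjE)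
      from bspec[OF bspec[OF this k(1)] k(2)]
      have "has_Z2_homology_of_sphere (int r - 1 - (int (card G) - 1) - 1) (link G X)" .
      moreover have "int r - 1 - (int (card G) - 1) - 1 = int (r - card G) - 1" using g by linarith
      ultimately show ?thesis by (simp only:)
    qed
  qed
  then show ?thesis using P by (simp add: manifold_def)
qed


section \<open>Extension of the partial isomorphism\<close>

lemma mem_faces_between:
  "A \<in> faces_between (int j - 1) (int j) X \<longleftrightarrow> A \<in> X \<and> (card A = j \<or> card A = Suc j)"
  by (auto simp: faces_between_def faces_def face_dim_def)

text \<open>Ranks are preserved because a face of the lower rank lies properly below some element of the
  poset, and a face of the upper rank properly above one.\<close>

lemma poset_iso_ranks_map:
  assumes X: "manifold U r X" and Y: "simplicial_complex Y" and j: "j + 1 \<le> r"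
    and iso: "poset_iso \<phi> (faces_between (int j - 1) (int j) X) (faces_between (int j - 1) (int j) Y)"
  shows "ranks_map j X Y \<phi>"
proof -
  let ?P = "faces_between (int j - 1) (int j) X" and ?Q = "faces_between (int j - 1) (int j) Y"
  have c: "simplicial_complex X" by (rule manifold_complex[OF X])
  have im: "\<phi> A \<in> ?Q" if "A \<in> ?P" for A using iso that by (auto simp: poset_iso_def bij_betw_def)
  have ord: "\<phi> A \<subseteq> \<phi> B \<longleftrightarrow> A \<subseteq> B" if "A \<in> ?P" "B \<in> ?P" for A B
    using iso that by (auto simp: poset_iso_def)
  have strict: "card (\<phi> A) = j \<and> card (\<phi> B) = Suc j" if AB: "A \<in> ?P" "B \<in> ?P" "A \<subset> B" for A B
  proof -
    have sub: "\<phi> A \<subset> \<phi> B" using ord[OF AB(1,2)] ord[OF AB(2,1)] AB(3) by blast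
    have Q: "\<phi> A \<in> Y \<and> (card (\<phi> A) = j \<or> card (\<phi> A) = Suc j)" "\<phi> B \<in> Y \<and> (card (\<phi> B) = j \<or> card (\<phi> B) = Suc j)"
      using im[OF AB(1)] im[OF AB(2)] by (simp_all add: mem_faces_between)
    have "card (\<phi> A) < card (\<phi> B)"
      using psubset_card_mono[OF complexD(2)[OF Y] sub] Q by blast
    then show ?thesis using Q by linarith
  qed
  have lower: "card (\<phi> A) = j" if A: "A \<in> X" "card A = j" for A
  proof -
    obtain B where B: "B \<in> X" "A \<subseteq> B" "card B = Suc j" using manifold_extend[OF X A(1), of "Suc j"] A j by auto
    then have "A \<subset> B" using A by auto
    then show ?thesis using strict[of A B] A B by (simp add: mem_faces_between)
  qed
  have upper: "card (\<phi> B) = Suc j" if B: "B \<in> X" "card B = Suc j" for B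
  proof -
    have fB: "finite B" using complexD(2)[OF c B(1)] .
    have "j \<le> card B" using B by simp
    then obtain A where A: "A \<subseteq> B" "card A = j" using obtain_subset_with_card_n by metis
    then have "A \<subset> B" "A \<in> X" using B complexD(1)[OF c B(1)] by auto
    then show ?thesis using strict[of A B] A B by (simp add: mem_faces_between)
  qed
  show ?thesis unfolding ranks_map_def
  proof (intro conjI ballI impI)
    fix A assume A: "A \<in> X" "card A = j \<or> card A = Suc j"
    show "\<phi> A \<in> Y" using im[of A] A by (simp add: mem_faces_between)
    show "card (\<phi> A) = card A" using A lower upper by auto
  next
    fix A B assume "A \<in> X" "B \<in> X" "card A = j \<and> card B = Suc j \<and> A \<subseteq> B"
    then show "\<phi> A \<subseteq> \<phi> B" using ord[of A B] by (simp add: mem_faces_between)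
  qed
qed

lemma poset_iso_inv:
  assumes "poset_iso \<phi> P Q" shows "poset_iso (inv_into P \<phi>) Q P"
proof -
  have bij: "bij_betw \<phi> P Q" and ord: "\<And>A B. A \<in> P \<Longrightarrow> B \<in> P \<Longrightarrow> A \<subseteq> B \<longleftrightarrow> \<phi> A \<subseteq> \<phi> B"
    using assms by (auto simp: poset_iso_def)
  have b': "bij_betw (inv_into P \<phi>) Q P" by (rule bij_betw_inv_into[OF bij])
  have "A \<subseteq> B \<longleftrightarrow> inv_into P \<phi> A \<subseteq> inv_into P \<phi> B" if "A \<in> Q" "B \<in> Q" for A B
    using ord[of "inv_into P \<phi> A" "inv_into P \<phi> B"] bij_betwE[OF b'] bij_betw_inv_into_right[OF bij] that
    by simp
  then show ?thesis using b' by (simp add: poset_iso_def)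
qed

lemma poset_iso_ranks_iso:
  assumes X: "manifold U r X" and Y: "manifold U' r Y" and j: "j + 1 \<le> r"
    and iso: "poset_iso \<phi> (faces_between (int j - 1) (int j) X) (faces_between (int j - 1) (int j) Y)"
  shows "ranks_iso j X Y \<phi> (inv_into (faces_between (int j - 1) (int j) X) \<phi>)"
proof -
  let ?P = "faces_between (int j - 1) (int j) X" and ?Q = "faces_between (int j - 1) (int j) Y"
  have bij: "bij_betw \<phi> ?P ?Q" using iso by (simp add: poset_iso_def)
  show ?thesis unfolding ranks_iso_def
  proof (intro conjI ballI impI)
    show "ranks_map j X Y \<phi>" by (rule poset_iso_ranks_map[OF X manifold_complex[OF Y] j iso])
    show "ranks_map j Y X (inv_into ?P \<phi>)"
      by (rule poset_iso_ranks_map[OF Y manifold_complex[OF X] j poset_iso_inv[OF iso]])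
  qed (use bij_betw_inv_into_left[OF bij] bij_betw_inv_into_right[OF bij] in \<open>simp_all add: mem_faces_between\<close>)
qed

lemma vertices_eq: "simplicial_complex X \<Longrightarrow> \<Union>X = {v. {v} \<in> X}"
  using complexD(1)[of X _ "{_}"] by auto

text \<open>The bounds on \<open>j\<close> say that the skeleton of dimension \<open>j\<close> reaches at least the middle dimension of
  the manifold. It is exactly the middle one if \<open>r = 2 * j + 1\<close>, and then the middle homology has to vanish.\<close>

lemma partial_poset_iso_extends:
  assumes X: "homology_manifold (int r - 1) X" and Y: "homology_manifold (int r - 1) Y"
    and j: "1 \<le> j" "j + 2 \<le> r" "r \<le> 2 * j + 1"
    and mid: "r = 2 * j + 1 \<Longrightarrow> trivial_group (Z2_homology (int j) X)"
      "r = 2 * j + 1 \<Longrightarrow> trivial_group (Z2_homology (int j) Y)"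
    and iso: "poset_iso \<phi> (faces_between (int j - 1) (int j) X) (faces_between (int j - 1) (int j) Y)"
  shows "extends_to_iso \<phi> (faces_between (int j - 1) (int j) X) X Y"
proof -
  have MX: "manifold (\<Union>X) r X" and MY: "manifold (\<Union>Y) r Y"
    using manifold_of_homology_manifold[OF X] manifold_of_homology_manifold[OF Y] .
  note cX = manifold_complex[OF MX] and cY = manifold_complex[OF MY]
  have jr: "j + 1 \<le> r" using j by simp
  obtain f where f: "bij_betw f {v. {v} \<in> X} {w. {w} \<in> Y}"
    "\<And>A. A \<in> X \<Longrightarrow> card A = j \<or> card A = Suc j \<Longrightarrow> \<phi> A = f ` A"
    "\<And>A. A \<subseteq> {v. {v} \<in> X} \<Longrightarrow> card A \<le> Suc j \<Longrightarrow> A \<in> X \<longleftrightarrow> f ` A \<in> Y"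
    using ranks_iso_skeleton[OF MX MY j(1,2) poset_iso_ranks_iso[OF MX MY jr iso]] by blast
  have inj: "inj_on f (\<Union>X)" and fU: "f ` \<Union>X = \<Union>Y"
    using f(1) by (simp_all add: bij_betw_def vertices_eq[OF cX] vertices_eq[OF cY])
  have PX: "X \<subseteq> Pow (\<Union>X)" and PY: "Y \<subseteq> Pow (\<Union>Y)" by auto
  have bndX: "bounds_in (\<Union>X) X (Suc j) z"
    if "2 * Suc j = r + 1" "chain X (Suc j) z" "boundary (\<Union>X) z = (\<lambda>_. 0)" for z
    using trivial_homology_bounds[OF cX PX manifold_finite[OF MX] _ _ that(2,3)] mid(1) that(1) by simp
  have bndY: "bounds_in (\<Union>Y) Y (Suc j) z"
    if "2 * Suc j = r + 1" "chain Y (Suc j) z" "boundary (\<Union>Y) z = (\<lambda>_. 0)" for z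
    using trivial_homology_bounds[OF cY PY manifold_finite[OF MY] _ _ that(2,3)] mid(2) that(1) by simp
  have "(`) f ` X = Y"
  proof (rule skeleton_determines[where s = "Suc j"])
    show "manifold (\<Union>Y) r ((`) f ` X)" using manifold_image[OF inj MX] unfolding fU .
    show "bounds_in (\<Union>Y) ((`) f ` X) (Suc j) z"
      if "2 * Suc j = r + 1" "chain ((`) f ` X) (Suc j) z" "boundary (\<Union>Y) z = (\<lambda>_. 0)" for z
      using cycles_bound_image[OF inj PX bndX[OF that(1)] that(2)] that(3) unfolding fU by blast
    show "A \<in> (`) f ` X \<longleftrightarrow> A \<in> Y" if A: "finite A" "card A \<le> Suc j" for A
    proof
      assume "A \<in> (`) f ` X"
      then obtain B where B: "B \<in> X" "A = f ` B" by auto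
      have BU: "B \<subseteq> \<Union>X" using B by auto
      have "card B = card A" using card_image[OF inj_on_subset[OF inj BU]] B by simp
      then show "A \<in> Y" using f(3)[of B] B BU A vertices_eq[OF cX] by simp
    next
      assume AY: "A \<in> Y"
      then have "A \<subseteq> f ` \<Union>X" using fU by auto
      then obtain B where B: "B \<subseteq> \<Union>X" "A = f ` B" by (auto simp: subset_image_iff)
      have "card B = card A" using card_image[OF inj_on_subset[OF inj B(1)]] B by simp
      then have "B \<in> X" using f(3)[of B] B A AY vertices_eq[OF cX] by simp
      then show "A \<in> (`) f ` X" using B by simp
    qed
  qed (use MY bndY j in simp_all)
  moreover have "inj_on ((`) f) X" by (rule inj_on_subset[OF inj_on_image_Pow[OF inj] PX])
  ultimately have bij: "bij_betw ((`) f) X Y" by (simp add: bij_betw_def)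
  have "A \<subseteq> B \<longleftrightarrow> f ` A \<subseteq> f ` B" if "A \<in> X" "B \<in> X" for A B
    using subset_if_image_subset[OF inj, of A B] that by auto
  then have "poset_iso ((`) f) X Y" using bij by (simp add: poset_iso_def)
  then show ?thesis
    unfolding extends_to_iso_def using f(2) by (intro exI[of _ "(`) f"]) (simp add: mem_faces_between)
qed

theorem theorem6p3:
  fixes X :: "'a set set" and Y :: "'b set set" and d :: int
  assumes "homology_manifold (d - 1) X" and "homology_manifold (d - 1) Y"
  shows "(\<forall>(k::int) \<phi>. d \<ge> 4 \<and> \<lceil>real_of_int d / 2\<rceil> \<le> k \<and> k \<le> d - 2 \<and>
            poset_iso \<phi> (faces_between (k - 1) k X) (faces_between (k - 1) k Y) \<longrightarrow>
            extends_to_iso \<phi> (faces_between (k - 1) k X) X Y) \<and>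
         (\<forall>(k::int) \<phi>. d \<ge> 3 \<and> odd d \<and>
            trivial_group (Z2_homology ((d - 1) div 2) X) \<and>
            trivial_group (Z2_homology ((d - 1) div 2) Y) \<and>
            (d - 1) div 2 \<le> k \<and> k \<le> d - 2 \<and>
            poset_iso \<phi> (faces_between (k - 1) k X) (faces_between (k - 1) k Y) \<longrightarrow>
            extends_to_iso \<phi> (faces_between (k - 1) k X) X Y)"
proof -
  have main: "extends_to_iso \<phi> (faces_between (k - 1) k X) X Y"
    if k: "1 \<le> k" "k \<le> d - 2" "d \<le> 2 * k + 1"
      and mid: "d = 2 * k + 1 \<Longrightarrow> trivial_group (Z2_homology k X) \<and> trivial_group (Z2_homology k Y)"
      and iso: "poset_iso \<phi> (faces_between (k - 1) k X) (faces_between (k - 1) k Y)"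
    for k :: int and \<phi>
  proof -
    obtain j r where jr: "k = int j" "d = int r"
      using k nonneg_int_cases[of k] nonneg_int_cases[of d] by (metis add.commute diff_ge_0_iff_ge le_add_diff_inverse order_trans zero_le_numeral zero_le_one)
    show ?thesis
      using partial_poset_iso_extends[of r X Y j \<phi>] assms k mid iso unfolding jr by simp
  qed
  show ?thesis
  proof (intro conjI allI impI)
    fix k :: int and \<phi> :: "'a set \<Rightarrow> 'b set"
    assume a: "d \<ge> 4 \<and> \<lceil>real_of_int d / 2\<rceil> \<le> k \<and> k \<le> d - 2 \<and>
      poset_iso \<phi> (faces_between (k - 1) k X) (faces_between (k - 1) k Y)"
    then have "real_of_int d / 2 \<le> real_of_int k" by (simp add: ceiling_le_iff)
    then have "d \<le> 2 * k" by linarith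
    then show "extends_to_iso \<phi> (faces_between (k - 1) k X) X Y"
      using a by (intro main) auto
  next
    fix k :: int and \<phi> :: "'a set \<Rightarrow> 'b set"
    assume a: "d \<ge> 3 \<and> odd d \<and>
      trivial_group (Z2_homology ((d - 1) div 2) X) \<and> trivial_group (Z2_homology ((d - 1) div 2) Y) \<and>
      (d - 1) div 2 \<le> k \<and> k \<le> d - 2 \<and>
      poset_iso \<phi> (faces_between (k - 1) k X) (faces_between (k - 1) k Y)"
    then obtain m where m: "d = 2 * m + 1" by (auto elim: oddE)
    then show "extends_to_iso \<phi> (faces_between (k - 1) k X) X Y"
      using a by (intro main) auto
  qed
qed

end
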